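(* Let $d,\ell\in\mathbb{N}=\{1,2,\ldots\}$ and let $\mu$ be a Borel probability measure on $[0,1]^d$ such that $\mu(\partial Q)=0$ for every dyadic cube $Q\in\bigcup_{n\ge 1}\mathcal{Q}_n$. Then for $\mu$-almost every $x$, \[ \lim_{n\to\infty}\frac1n\left(-\log\mu(\mathcal{Q}_n(x))-\frac1\ell\sum_{i=1}^n H\left(\mu_\ell^{\mathcal{Q}_i(x)}\right)\right)=0. \] In particular, for $\mu$-almost every $x$, \[ \overline{\dim}(\mu,x)=\limsup_{n\to\infty}\frac{1}{\ell n}\sum_{i=1}^n H\left(\mu_\ell^{\mathcal{Q}_i(x)}\right) \quad\text{and}\quad \underline{\dim}(\mu,x)=\liminf_{n\to\infty}\frac{1}{\ell n}\sum_{i=1}^n H\left(\mu_\ell^{\mathcal{Q}_i(x)}\right). \]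
   Context: All logarithms are to base $2$. Dyadic cubes: for $n\in\{0,1,2,\ldots\}$, $\mathcal{Q}_n$ is the collection of half-open dyadic cubes $I_1\times\cdots\times I_d$ with $I_i=[j_i2^{-n},(j_i+1)2^{-n})$ and integers $0\le j_i<2^n$; these partition $[0,1)^d$. For $x\in[0,1)^d$, $\mathcal{Q}_n(x)$ is the unique cube of $\mathcal{Q}_n$ containing $x$. For $Q\in\mathcal{Q}_n$ and $\ell\ge1$, $\mathcal{Q}_\ell(Q)$ is the collection of cubes of $\mathcal{Q}_{n+\ell}$ contained in $Q$. (Since the boundaries of dyadic cubes have zero $\mu$-measure, $\mu$-almost every $x$ lies in $[0,1)^d$.) Conditional measures: for a dyadic cube $Q$ with $\mu(Q)>0$, $\mu_\ell^Q$ is the probability vector (discrete probability measure with $2^{d\ell}$ atoms) indexed by $R\in\mathcal{Q}_\ell(Q)$ and given by $\mu_\ell^Q(R)=\mu(R)/\mu(Q)$. Entropy: for a probability vector $p=(p_1,\ldots,p_N)$, $H(p)=\sum_{i=1}^N -p_i\log p_i$ (with $0\log 0=0$). Local dimensions: with $B(x,r)$ the open Euclidean ball of center $x$ and radius $r$, \[ \overline{\dim}(\mu,x)=\limsup_{r\to0}\frac{\log\mu(B(x,r))}{\log r},\qquad \underline{\dim}(\mu,x)=\liminf_{r\to0}\frac{\log\mu(B(x,r))}{\log r}. \] *)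

theory Defs
  imports "HOL-Probability.Probability"
begin

definition dyadic_cubes :: "nat \<Rightarrow> (real ^ 'd) set set" where
  "dyadic_cubes n =
     {{x. \<forall>i. x $ i \<in> {real (j i) / 2 ^ n ..< (real (j i) + 1) / 2 ^ n}} | j. \<forall>i. j i < (2::nat) ^ n}"

text \<open>The cubes of one level partition the half-open unit cube, so the following description is
  proper exactly for points of that cube; elsewhere the value is unspecified.\<close>

definition dyadic_cube_at :: "nat \<Rightarrow> real ^ 'd \<Rightarrow> (real ^ 'd) set" where
  "dyadic_cube_at n x = (THE Q. Q \<in> dyadic_cubes n \<and> x \<in> Q)"

text \<open>The level \<open>n\<close> of the parent cube \<open>Q\<close> is passed explicitly rather than recovered from \<open>Q\<close>.\<close>

definition subcubes :: "nat \<Rightarrow> nat \<Rightarrow> (real ^ 'd) set \<Rightarrow> (real ^ 'd) set set" where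
  "subcubes n l Q = {R \<in> dyadic_cubes (n + l). R \<subseteq> Q}"

definition conditional_vector :: "'a measure \<Rightarrow> 'a set \<Rightarrow> 'a set \<Rightarrow> real" where
  "conditional_vector \<mu> Q R = measure \<mu> R / measure \<mu> Q"

text \<open>Terms with \<open>p i = 0\<close> vanish, in accordance with \<open>0 log 0 = 0\<close>.\<close>

definition vector_entropy :: "'i set \<Rightarrow> ('i \<Rightarrow> real) \<Rightarrow> real" where
  "vector_entropy I p = (\<Sum>i\<in>I. - p i * log 2 (p i))"

definition cube_entropy :: "(real ^ 'd) measure \<Rightarrow> nat \<Rightarrow> nat \<Rightarrow> real ^ 'd \<Rightarrow> real" where
  "cube_entropy \<mu> l n x =
     vector_entropy (subcubes n l (dyadic_cube_at n x)) (conditional_vector \<mu> (dyadic_cube_at n x))"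

text \<open>Base 2 logarithm with the convention \<open>log 0 = -\<infinity>\<close> (in the library, \<open>log 2 0 = 0\<close>); with it
  both local dimensions are \<open>\<infinity>\<close> at points outside the support of the measure.\<close>

definition elog2 :: "real \<Rightarrow> ereal" where
  "elog2 t = (if t \<le> 0 then - \<infinity> else ereal (log 2 t))"

definition upper_local_dim :: "'a::metric_space measure \<Rightarrow> 'a \<Rightarrow> ereal" where
  "upper_local_dim \<mu> x = Limsup (at_right 0) (\<lambda>r. elog2 (measure \<mu> (ball x r)) / ereal (log 2 r))"

definition lower_local_dim :: "'a::metric_space measure \<Rightarrow> 'a \<Rightarrow> ereal" where
  "lower_local_dim \<mu> x = Liminf (at_right 0) (\<lambda>r. elog2 (measure \<mu> (ball x r)) / ereal (log 2 r))"

end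

theory Submission
  imports Defs "HOL-Library.Discrete_Functions"
begin

text \<open>
  Write \<open>g n x = - log \<mu>(Q\<^sub>n(x))\<close>, the information in the level \<open>n\<close> dyadic address of \<open>x\<close>. Passing from
  level \<open>i\<close> to level \<open>i + l\<close> reveals the amount \<open>g (i + l) x - g i x\<close> of new information, and its
  conditional mean over a cube of level \<open>i\<close> is precisely the entropy \<open>H\<close> of the conditional vector of
  that cube. The excess \<open>X\<^sub>i\<close> of information over entropy therefore has mean zero on every cube of level \<open>i\<close>
  and is constant on cubes of level \<open>i + l\<close>, so \<open>X\<^sub>i\<close> and \<open>X\<^sub>j\<close> are orthogonal as soon as
  \<open>\<bar>i - j\<bar> \<ge> l\<close>. Their second moments are bounded because \<open>p (log p)\<^sup>2\<close> is bounded on \<open>[0, 1]\<close> and a cube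
  has \<open>2\<^sup>d\<^sup>l\<close> subcubes. A second moment law of large numbers gives \<open>(1/n) \<Sum> X\<^sub>i \<rightarrow> 0\<close> almost everywhere
  (\<open>AE_averages_of_finite_range_orthogonal\<close>). The sum of the information gains telescopes to
  \<open>l g n x\<close>, up to the gains \<open>g (n + j) x - g n x\<close> with \<open>j \<le> l\<close> and a term that does not depend on \<open>n\<close>;
  as the gains over boundedly many levels are \<open>o(n)\<close>, the first claim follows
  (\<open>AE_log_cell_prob_entropy_averages\<close>).

  For the local dimensions, a ball of radius about \<open>2\<^sup>-\<^sup>n\<close> around \<open>x\<close> contains the cube around \<open>x\<close> of
  level \<open>n + d\<close>, which gives one inequality. In the other direction the ball can meet neighbouring
  cubes that are much heavier than \<open>Q\<^sub>n(x)\<close>, but only for few \<open>x\<close>: the cubes \<open>Q\<close> with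
  \<open>\<mu>(Q) \<le> 2\<^sup>-\<^sup>\<epsilon>\<^sup>n \<mu>(N(Q))\<close>, where \<open>N(Q)\<close> is the \<open>2\<^sup>-\<^sup>n\<close>-neighbourhood, have total mass at most
  \<open>3\<^sup>d 2\<^sup>-\<^sup>\<epsilon>\<^sup>n\<close>, since no point lies in more than \<open>3\<^sup>d\<close> neighbourhoods. By Borel--Cantelli almost every
  \<open>x\<close> meets finitely many such cubes (\<open>AE_neighbourhood_prob_le\<close>). The same lemma, with \<open>N(R)\<close> the
  ancestor of \<open>R\<close> a fixed number of levels up, yields the \<open>o(n)\<close> bound on the information gains.
  Hence \<open>log \<mu>(B(x,r)) / log r\<close> differs from \<open>g n x / n\<close>, for \<open>n = \<lfloor>- log r\<rfloor>\<close>, by a quantity that tends to 0 with \<open>r\<close>, and upper and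
  lower limits agree with those of the entropy averages.

  The probabilistic part uses only that the cubes form nested finite partitions in which
  every cell has boundedly many descendants at each relative depth; it is carried out in the locale
  \<open>nested_partitions\<close>. The dyadic cubes satisfy its axioms on the half-open unit cube, which carries
  all the mass because the faces of the unit cube lie in the frontiers of dyadic cubes.
\<close>

section \<open>A law of large numbers for orthogonality at finite range\<close>

text \<open>Consecutive squares have ratio tending to 1, so a monotone function is pinned between its values at
  \<open>k\<^sup>2\<close> and \<open>(k + 1)\<^sup>2\<close>, where \<open>k\<close> is the integer square root of \<open>n\<close>.\<close>

lemma tendsto_of_monotone_along_squares:
  fixes t :: "nat \<Rightarrow> real"
  assumes mono: "mono t" and nonneg: "\<And>n. 0 \<le> t n"
    and lim: "(\<lambda>k. t (k\<^sup>2) / real (k\<^sup>2)) \<longlonglongrightarrow> K"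
  shows "(\<lambda>n. t n / real n) \<longlonglongrightarrow> K"
proof -
  have sqrt_top: "filterlim floor_sqrt at_top sequentially"
    unfolding filterlim_at_top
  proof
    fix Z :: nat
    show "eventually (\<lambda>n. Z \<le> floor_sqrt n) sequentially"
      using eventually_ge_at_top[of "Z\<^sup>2"]
    proof eventually_elim
      case (elim n)
      then show ?case using mono_floor_sqrt'[of "Z\<^sup>2" n] by simp
    qed
  qed
  define lo where "lo k = t (k\<^sup>2) / real (k\<^sup>2) * (real k / real (k + 1))\<^sup>2" for k
  define hi where "hi k = t ((k + 1)\<^sup>2) / real ((k + 1)\<^sup>2) * (real (k + 1) / real k)\<^sup>2" for k
  have r1: "(\<lambda>k. real k / real (k + 1)) \<longlonglongrightarrow> 1"
    using LIMSEQ_n_over_Suc_n by simp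
  have r2: "(\<lambda>k. real (k + 1) / real k) \<longlonglongrightarrow> 1"
    using LIMSEQ_Suc_n_over_n by simp
  have lo: "lo \<longlonglongrightarrow> K"
    using tendsto_mult[OF lim tendsto_power[OF r1, of 2]] unfolding lo_def by simp
  have hi: "hi \<longlonglongrightarrow> K"
    using tendsto_mult[OF LIMSEQ_ignore_initial_segment[OF lim, of 1] tendsto_power[OF r2, of 2]]
    unfolding hi_def by simp
  show ?thesis
  proof (rule tendsto_sandwich)
    show "(\<lambda>n. lo (floor_sqrt n)) \<longlonglongrightarrow> K" by (rule filterlim_compose[OF lo sqrt_top])
    show "(\<lambda>n. hi (floor_sqrt n)) \<longlonglongrightarrow> K" by (rule filterlim_compose[OF hi sqrt_top])
    show "eventually (\<lambda>n. lo (floor_sqrt n) \<le> t n / real n) sequentially"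
      using eventually_gt_at_top[of 0]
    proof eventually_elim
      case (elim n)
      define k where "k = floor_sqrt n"
      have k: "k\<^sup>2 \<le> n" "n < (k + 1)\<^sup>2" "k > 0"
        using elim Suc_floor_sqrt_power2_gt[of n] by (auto simp: k_def)
      have "lo k = t (k\<^sup>2) / real ((k + 1)\<^sup>2)"
        using k by (simp add: lo_def power_divide)
      also have "\<dots> \<le> t n / real n"
        using k elim monoD[OF mono k(1)] nonneg
        by (intro frac_le) (simp_all del: of_nat_power)
      finally show ?case by (simp add: k_def)
    qed
    show "eventually (\<lambda>n. t n / real n \<le> hi (floor_sqrt n)) sequentially"
      using eventually_gt_at_top[of 0]
    proof eventually_elim
      case (elim n)
      define k where "k = floor_sqrt n"
      have k: "k\<^sup>2 \<le> n" "n < (k + 1)\<^sup>2" "k > 0"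
        using elim Suc_floor_sqrt_power2_gt[of n] by (auto simp: k_def)
      have "t n / real n \<le> t ((k + 1)\<^sup>2) / real (k\<^sup>2)"
        using k monoD[OF mono less_imp_le[OF k(2)]] nonneg by (intro frac_le) (auto simp del: of_nat_power)
      also have "\<dots> = hi k"
        using k unfolding hi_def power_divide of_nat_power by (simp add: field_simps del: of_nat_Suc of_nat_add)
      finally show ?case by (simp add: k_def)
    qed
  qed
qed

text \<open>Adding the constant \<open>K\<close> to every term makes the partial sums monotone and shifts the limit of the
  averages by \<open>K\<close>.\<close>

lemma tendsto_averages_of_squares:
  fixes X :: "nat \<Rightarrow> real"
  assumes lower: "\<And>i. - K \<le> X i" and K: "0 \<le> K"
    and lim: "(\<lambda>k. (\<Sum>i=1..k\<^sup>2. X i) / real (k\<^sup>2)) \<longlonglongrightarrow> 0"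
  shows "(\<lambda>n. (\<Sum>i=1..n. X i) / real n) \<longlonglongrightarrow> 0"
proof -
  define t where "t n = (\<Sum>i=1..n. X i + K)" for n
  have t: "t n = (\<Sum>i=1..n. X i) + K * real n" for n
    by (simp add: t_def sum.distrib mult.commute)
  have "mono t"
    unfolding mono_iff_le_Suc using lower by (auto simp: t_def) (smt (verit) lower)
  moreover have "0 \<le> t n" for n
    unfolding t_def by (intro sum_nonneg) (smt (verit) lower)
  moreover have "(\<lambda>k. t (k\<^sup>2) / real (k\<^sup>2)) \<longlonglongrightarrow> K"
  proof -
    have "eventually (\<lambda>k. (\<Sum>i=1..k\<^sup>2. X i) / real (k\<^sup>2) + K = t (k\<^sup>2) / real (k\<^sup>2)) sequentially"
      using eventually_gt_at_top[of 0] by eventually_elim (simp add: t add_divide_distrib)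
    from Lim_transform_eventually[OF tendsto_add[OF lim tendsto_const[of K]] this]
    show ?thesis by simp
  qed
  ultimately have "(\<lambda>n. t n / real n) \<longlonglongrightarrow> K"
    by (rule tendsto_of_monotone_along_squares)
  then have lim: "(\<lambda>n. t n / real n - K) \<longlonglongrightarrow> 0"
    using tendsto_diff[OF _ tendsto_const[of K]] by fastforce
  have "eventually (\<lambda>n. t n / real n - K = (\<Sum>i=1..n. X i) / real n) sequentially"
    using eventually_gt_at_top[of 0] by eventually_elim (simp add: t add_divide_distrib)
  from Lim_transform_eventually[OF lim this] show ?thesis .
qed

text \<open>Only \<open>O(n)\<close> of the \<open>n\<^sup>2\<close> products in the square of the partial sum \<open>S n\<close> have nonzero mean, so
  \<open>S n / n\<close> has second moment \<open>O(1/n)\<close>. This is summable along the squares, which gives almost sure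
  convergence there, and the lower bound \<open>- K\<close> bridges the gaps between squares.\<close>

lemma (in prob_space) AE_averages_of_finite_range_orthogonal:
  fixes X :: "nat \<Rightarrow> 'a \<Rightarrow> real"
  assumes meas: "\<And>i. X i \<in> borel_measurable M"
    and int: "\<And>i j. integrable M (\<lambda>x. X i x * X j x)"
    and bound: "\<And>i. expectation (\<lambda>x. (X i x)\<^sup>2) \<le> C"
    and orth: "\<And>i j. i + l \<le> j \<Longrightarrow> expectation (\<lambda>x. X i x * X j x) = 0"
    and lower: "\<And>i x. x \<in> space M \<Longrightarrow> - K \<le> X i x" and K: "0 \<le> K"
  shows "AE x in M. (\<lambda>n. (\<Sum>i=1..n. X i x) / real n) \<longlonglongrightarrow> 0"
proof -
  note [measurable] = meas
  define S where "S n x = (\<Sum>i=1..n. X i x)" for n x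
  have [measurable]: "S n \<in> borel_measurable M" for n unfolding S_def by measurable
  have C: "0 \<le> C" 
    by (rule order_trans[OF integral_nonneg_AE bound[of 0]]) simp
  have cross: "expectation (\<lambda>x. X i x * X j x) \<le> C" for i j
  proof -
    have "expectation (\<lambda>x. X i x * X j x) \<le> expectation (\<lambda>x. ((X i x)\<^sup>2 + (X j x)\<^sup>2) / 2)"
    proof (rule integral_mono)
      show "integrable M (\<lambda>x. ((X i x)\<^sup>2 + (X j x)\<^sup>2) / 2)"
        using int[of i i] int[of j j] by (auto simp: power2_eq_square)
      show "X i x * X j x \<le> ((X i x)\<^sup>2 + (X j x)\<^sup>2) / 2" for x
        using sum_squares_bound[of "X i x" "X j x"] by simp
    qed (rule int)
    also have "\<dots> = (expectation (\<lambda>x. (X i x)\<^sup>2) + expectation (\<lambda>x. (X j x)\<^sup>2)) / 2"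
      using int[of i i] int[of j j] by (simp add: power2_eq_square)
    also have "\<dots> \<le> C" using bound[of i] bound[of j] by simp
    finally show ?thesis .
  qed
  have S_sq: "(S n x)\<^sup>2 = (\<Sum>i=1..n. \<Sum>j=1..n. X i x * X j x)" for n x
    by (simp add: S_def power2_eq_square sum_product)
  have S_int: "integrable M (\<lambda>x. (S n x)\<^sup>2)" for n
    unfolding S_sq by (intro Bochner_Integration.integrable_sum int)
  have S_bound: "expectation (\<lambda>x. (S n x)\<^sup>2) \<le> real n * (real (2 * l) * C)" for n
  proof -
    have row: "(\<Sum>j=1..n. expectation (\<lambda>x. X i x * X j x)) \<le> real (2 * l) * C" for i
    proof -
      let ?J = "{j \<in> {1..n}. j < i + l \<and> i < j + l}"
      have "(\<Sum>j=1..n. expectation (\<lambda>x. X i x * X j x)) = (\<Sum>j\<in>?J. expectation (\<lambda>x. X i x * X j x))"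
      proof (rule sum.mono_neutral_right)
        show "\<forall>j\<in>{1..n} - ?J. expectation (\<lambda>x. X i x * X j x) = 0"
        proof
          fix j assume "j \<in> {1..n} - ?J"
          then have "i + l \<le> j \<or> j + l \<le> i" by auto
          then show "expectation (\<lambda>x. X i x * X j x) = 0"
            using orth[of i j] orth[of j i] by (auto simp: mult.commute)
        qed
      qed auto
      also have "\<dots> \<le> real (card ?J) * C"
        using sum_bounded_above[of ?J "\<lambda>j. expectation (\<lambda>x. X i x * X j x)" C] cross by simp
      also have "card ?J \<le> card {i + 1 - l..<i + l}"
        by (intro card_mono) auto
      then have "real (card ?J) * C \<le> real (2 * l) * C"
        using C by (intro mult_right_mono) auto
      finally show ?thesis .
    qed
    have "expectation (\<lambda>x. (S n x)\<^sup>2) = (\<Sum>i=1..n. \<Sum>j=1..n. expectation (\<lambda>x. X i x * X j x))"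
      unfolding S_sq by (simp add: int)
    also have "\<dots> \<le> (\<Sum>i=1..n. real (2 * l) * C)" by (intro sum_mono row)
    finally show ?thesis by simp
  qed
  define Y where "Y k x = (S ((Suc k)\<^sup>2) x / real ((Suc k)\<^sup>2))\<^sup>2" for k x
  have [measurable]: "Y k \<in> borel_measurable M" for k unfolding Y_def by measurable
  have Y_nn: "0 \<le> Y k x" for k x by (simp add: Y_def)
  have Y_int: "integrable M (Y k)" for k
    unfolding Y_def power_divide by (intro integrable_divide_zero S_int)
  have Y_bound: "expectation (Y k) \<le> (real (2 * l) * C) * (1 / (real (Suc k))\<^sup>2)" for k
  proof -
    define q where "q = real ((Suc k)\<^sup>2)"
    have q: "q > 0" by (simp add: q_def)
    have "expectation (Y k) = expectation (\<lambda>x. (S ((Suc k)\<^sup>2) x)\<^sup>2) / q\<^sup>2"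
      unfolding Y_def power_divide q_def by simp
    also have "\<dots> \<le> q * (real (2 * l) * C) / q\<^sup>2"
      using S_bound[of "(Suc k)\<^sup>2"] by (intro divide_right_mono) (simp_all only: q_def zero_le_power2)
    also have "\<dots> = (real (2 * l) * C) * (1 / q)"
      using q by (simp add: power2_eq_square)
    finally show ?thesis by (simp add: q_def)
  qed
  have "summable (\<lambda>k. (real (2 * l) * C) * (1 / (real (Suc k))\<^sup>2))"
    using inverse_power_summable[of 2, where 'a=real] 
    by (intro summable_mult) (simp add: inverse_eq_divide summable_Suc_iff[of "\<lambda>n. 1 / (real n)\<^sup>2"] del: of_nat_Suc)
  then have Y_sum: "summable (\<lambda>k. expectation (Y k))"
    by (rule summable_comparison_test'[where N=0])
       (use Y_bound Y_nn in \<open>auto intro!: integral_nonneg simp: abs_of_nonneg simp del: of_nat_Suc\<close>)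
  have "(\<integral>\<^sup>+x. (\<Sum>k. ennreal (Y k x)) \<partial>M) = (\<Sum>k. \<integral>\<^sup>+x. ennreal (Y k x) \<partial>M)"
    by (intro nn_integral_suminf) measurable
  also have "\<dots> = (\<Sum>k. ennreal (expectation (Y k)))"
    by (intro suminf_cong nn_integral_eq_integral Y_int AE_I2 Y_nn)
  also have "\<dots> = ennreal (\<Sum>k. expectation (Y k))"
    using Y_sum Y_nn by (intro suminf_ennreal2) (auto intro!: integral_nonneg)
  finally have "(\<integral>\<^sup>+x. (\<Sum>k. ennreal (Y k x)) \<partial>M) \<noteq> \<infinity>" by simp
  then have "AE x in M. (\<Sum>k. ennreal (Y k x)) \<noteq> \<infinity>"
    by (intro nn_integral_PInf_AE) measurable
  then show ?thesis
  proof (rule AE_mp, intro AE_I2 impI)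
    fix x assume x: "x \<in> space M" and fin: "(\<Sum>k. ennreal (Y k x)) \<noteq> \<infinity>"
    have "summable (\<lambda>k. Y k x)"
      using fin Y_nn by (intro summable_suminf_not_top) (auto simp: infinity_ennreal_def)
    then have "(\<lambda>k. Y k x) \<longlonglongrightarrow> 0" by (rule summable_LIMSEQ_zero)
    then have "(\<lambda>k. S ((Suc k)\<^sup>2) x / real ((Suc k)\<^sup>2)) \<longlonglongrightarrow> 0"
      unfolding Y_def by (rule power_tendsto_0_iff[THEN iffD1, rotated]) simp
    then have "(\<lambda>k. S (k\<^sup>2) x / real (k\<^sup>2)) \<longlonglongrightarrow> 0"
      by (rule LIMSEQ_imp_Suc)
    then show "(\<lambda>n. (\<Sum>i=1..n. X i x) / real n) \<longlonglongrightarrow> 0"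
      unfolding S_def using x by (intro tendsto_averages_of_squares[OF lower K]) auto
  qed
qed

section \<open>Information and entropy along nested finite partitions\<close>


text \<open>Everything comes from \<open>- s ln s \<le> 1\<close> on \<open>[0, 1]\<close>, which is \<open>ln y \<le> y - 1\<close> at \<open>y = 1/s\<close>. The square
  \<open>p (log p)\<^sup>2\<close> is reduced to it by \<open>s = sqrt p\<close>. The constants are not sharp: \<open>ln 2\<close> is
  replaced by \<open>1/2\<close>.\<close>

lemma entropy_term_bounds:
  fixes p :: real
  assumes "0 \<le> p" "p \<le> 1"
  shows "0 \<le> - p * log 2 p" "- p * log 2 p \<le> 2" "p * (log 2 p)\<^sup>2 \<le> 16"
proof -
  have s_ln: "0 \<le> - s * ln s \<and> - s * ln s \<le> 1" if "0 \<le> s" "s \<le> 1" for s :: real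
  proof (cases "s = 0")
    case False
    with that have s: "0 < s" by simp
    have "- ln s \<le> 1 / s - 1"
      using ln_le_minus_one[of "1 / s"] s by (simp add: ln_div)
    then have "s * (- ln s) \<le> s * (1 / s - 1)" using s by (intro mult_left_mono) auto
    also have "\<dots> \<le> 1" using s by (simp add: field_simps)
    finally show ?thesis using s that by (simp add: mult_nonneg_nonpos)
  qed simp
  have ln2: "ln 2 \<ge> (1/2 :: real)" using ln2_ge_two_thirds by simp
  have eq: "- p * log 2 p = (- p * ln p) / ln 2" by (simp add: log_def)
  show "0 \<le> - p * log 2 p" unfolding eq using s_ln[of p] assms
    by (intro divide_nonneg_nonneg) auto
  have "(- p * ln p) / ln 2 \<le> 1 / (1/2)"
    using s_ln[of p] assms ln2 by (intro frac_le) auto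
  then show "- p * log 2 p \<le> 2" unfolding eq by simp
  define s where "s = sqrt p"
  have s: "0 \<le> s" "s \<le> 1" "p = s\<^sup>2" using assms by (auto simp: s_def)
  have "p * (log 2 p)\<^sup>2 = (2 * (- s * ln s) / ln 2)\<^sup>2"
  proof (cases "s = 0")
    case False
    then have "ln p = 2 * ln s" using s by (simp add: ln_realpow)
    then show ?thesis unfolding log_def s(3) by (simp add: power_divide power_mult_distrib)
  qed (simp add: s(3))
  also have "\<dots> \<le> (2 / (1/2))\<^sup>2"
    using s_ln[OF s(1,2)] ln2 by (intro power_mono frac_le divide_nonneg_nonneg) auto
  finally show "p * (log 2 p)\<^sup>2 \<le> 16" by simp
qed

text \<open>The number \<open>B l\<close> bounds how many cells \<open>l\<close> levels below a given cell are contained in it. It does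
  not depend on the level of the given cell, and all moment bounds below are uniform for this reason.\<close>

locale nested_partitions = prob_space M for M :: "'a measure" +
  fixes D :: "nat \<Rightarrow> 'a set set" and B :: "nat \<Rightarrow> nat"
  assumes finite_D: "finite (D n)"
    and events_D: "Q \<in> D n \<Longrightarrow> Q \<in> events"
    and disjoint_D: "Q \<in> D n \<Longrightarrow> R \<in> D n \<Longrightarrow> x \<in> Q \<Longrightarrow> x \<in> R \<Longrightarrow> Q = R"
    and cover_D: "x \<in> space M \<Longrightarrow> \<exists>Q\<in>D n. x \<in> Q"
    and nested_D: "m \<le> n \<Longrightarrow> R \<in> D n \<Longrightarrow> Q \<in> D m \<Longrightarrow> x \<in> R \<Longrightarrow> x \<in> Q \<Longrightarrow> R \<subseteq> Q"
    and branching_D: "Q \<in> D n \<Longrightarrow> card {R \<in> D (n + l). R \<subseteq> Q} \<le> B l"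
begin

definition cell :: "nat \<Rightarrow> 'a \<Rightarrow> 'a set" where
  "cell n x = (THE Q. Q \<in> D n \<and> x \<in> Q)"

definition children :: "nat \<Rightarrow> nat \<Rightarrow> 'a set \<Rightarrow> 'a set set" where
  "children n l Q = {R \<in> D (n + l). R \<subseteq> Q}"

definition entropy_at :: "nat \<Rightarrow> nat \<Rightarrow> 'a \<Rightarrow> real" where
  "entropy_at l n x = vector_entropy (children n l (cell n x)) (conditional_vector M (cell n x))"

definition information_gain :: "nat \<Rightarrow> nat \<Rightarrow> 'a \<Rightarrow> real" where
  "information_gain l n x = - log 2 (conditional_vector M (cell n x) (cell (n + l) x))"

text \<open>Functions of the level \<open>n\<close> address of a point, that is, functions measurable with respect to the
  finite algebra generated by \<open>D n\<close>.\<close>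

definition cellwise :: "nat \<Rightarrow> ('a \<Rightarrow> real) \<Rightarrow> bool" where
  "cellwise n f \<longleftrightarrow> (\<exists>F. \<forall>x\<in>space M. f x = F (cell n x))"

lemma subset_space_D: "Q \<in> D n \<Longrightarrow> Q \<subseteq> space M"
  using events_D sets.sets_into_space by blast

lemma cell_eq: "Q \<in> D n \<Longrightarrow> x \<in> Q \<Longrightarrow> cell n x = Q"
  unfolding cell_def using disjoint_D by (intro the_equality) blast+

lemma cell_mem: assumes "x \<in> space M" shows "cell n x \<in> D n" "x \<in> cell n x"
  using cover_D[OF assms, of n] cell_eq by auto

lemma cell_mono: "x \<in> space M \<Longrightarrow> m \<le> n \<Longrightarrow> cell n x \<subseteq> cell m x"
  by (rule nested_D[of m n _ _ x]) (auto intro: cell_mem)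

lemma finite_children: "finite (children n l Q)"
  using finite_D by (simp add: children_def)

lemma card_children: "Q \<in> D n \<Longrightarrow> card (children n l Q) \<le> B l"
  unfolding children_def by (rule branching_D)

lemma cell_children: "x \<in> space M \<Longrightarrow> cell (n + l) x \<in> children n l (cell n x)"
  by (simp add: children_def cell_mem cell_mono)

lemma cell_of_child:
  assumes "Q \<in> D n" "R \<in> children n l Q" "x \<in> R"
  shows "cell n x = Q" "cell (n + l) x = R"
  using assms by (auto simp: children_def intro!: cell_eq)

lemma sum_indicator_cell:
  assumes "x \<in> space M"
  shows "(\<Sum>Q\<in>D n. F Q * indicator Q x) = (F (cell n x) :: real)"
proof -
  have "(\<Sum>Q\<in>D n. F Q * indicator Q x) = (\<Sum>Q\<in>D n. if Q = cell n x then F Q else 0)"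
    using assms by (intro sum.cong) (auto simp: indicator_def cell_mem dest: cell_eq)
  then show ?thesis using cell_mem[OF assms] finite_D by simp
qed

lemma cellwiseI: "(\<And>x. x \<in> space M \<Longrightarrow> f x = F (cell n x)) \<Longrightarrow> cellwise n f"
  unfolding cellwise_def by blast

text \<open>A cell of level \<open>n\<close> determines the cell of level \<open>m\<close> around it through any of its points; the
  choice operator picks one.\<close>

lemma cellwise_mono:
  assumes f: "cellwise m f" and mn: "m \<le> n"
  shows "cellwise n f"
proof -
  obtain F where F: "\<And>x. x \<in> space M \<Longrightarrow> f x = F (cell m x)"
    using f unfolding cellwise_def by blast
  have "cell m x = cell m (SOME y. y \<in> cell n x)" if x: "x \<in> space M" for x
  proof -
    have "(SOME y. y \<in> cell n x) \<in> cell n x"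
      using cell_mem(2)[OF x] by (rule someI)
    with cell_mono[OF x mn] have "(SOME y. y \<in> cell n x) \<in> cell m x" by blast
    then show ?thesis using cell_eq cell_mem[OF x] by metis
  qed
  with F show ?thesis
    by (intro cellwiseI[where F = "\<lambda>R. F (cell m (SOME y. y \<in> R))"]) metis
qed

lemma cellwise_diff: "cellwise n f \<Longrightarrow> cellwise n h \<Longrightarrow> cellwise n (\<lambda>x. f x - h x)"
  unfolding cellwise_def by (elim exE, rule_tac x = "\<lambda>Q. F Q - Fa Q" in exI) auto

lemma cellwise_mult: "cellwise n f \<Longrightarrow> cellwise n h \<Longrightarrow> cellwise n (\<lambda>x. f x * h x)"
  unfolding cellwise_def by (elim exE, rule_tac x = "\<lambda>Q. F Q * Fa Q" in exI) auto

lemma cellwise_integrable: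
  assumes "cellwise n f"
  shows "integrable M f"
proof -
  obtain F where F: "\<And>x. x \<in> space M \<Longrightarrow> f x = F (cell n x)"
    using assms unfolding cellwise_def by blast
  have "integrable M (\<lambda>x. \<Sum>Q\<in>D n. F Q * indicator Q x)"
    by (intro Bochner_Integration.integrable_sum integrable_mult_right integrable_real_indicator)
      (auto intro: events_D simp: emeasure_eq_measure)
  then show ?thesis
    by (subst Bochner_Integration.integrable_cong[OF refl]) (auto simp: sum_indicator_cell F)
qed

text \<open>The tower property in elementary form: if \<open>h\<close> has conditional mean zero given the
  cells of level \<open>n\<close>, it is orthogonal to all functions of these cells.\<close>

lemma integral_cellwise_mult:
  assumes "cellwise n f" and h: "integrable M h"
    and zero: "\<And>Q. Q \<in> D n \<Longrightarrow> expectation (\<lambda>x. indicator Q x * h x) = 0"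
  shows "expectation (\<lambda>x. f x * h x) = 0"
proof -
  obtain F where F: "\<And>x. x \<in> space M \<Longrightarrow> f x = F (cell n x)"
    using assms(1) unfolding cellwise_def by blast
  have int: "integrable M (\<lambda>x. indicator Q x * h x)" if "Q \<in> D n" for Q
    using integrable_mult_indicator[OF events_D[OF that] h] by simp
  have "expectation (\<lambda>x. f x * h x) = expectation (\<lambda>x. \<Sum>Q\<in>D n. F Q * (indicator Q x * h x))"
  proof (rule Bochner_Integration.integral_cong[OF refl])
    fix x assume x: "x \<in> space M"
    have "f x * h x = (\<Sum>Q\<in>D n. F Q * indicator Q x) * h x"
      by (simp add: F x sum_indicator_cell)
    then show "f x * h x = (\<Sum>Q\<in>D n. F Q * (indicator Q x * h x))"
      by (simp add: sum_distrib_right mult.assoc)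
  qed
  also have "\<dots> = (\<Sum>Q\<in>D n. F Q * expectation (\<lambda>x. indicator Q x * h x))"
    using int by (subst Bochner_Integration.integral_sum) auto
  also have "\<dots> = 0" by (simp add: zero)
  finally show ?thesis .
qed

lemma expectation_split_cells:
  fixes f :: "'a \<Rightarrow> real"
  assumes f: "integrable M f"
  shows "expectation f = (\<Sum>Q\<in>D n. expectation (\<lambda>x. indicator Q x * f x))"
proof -
  have int: "integrable M (\<lambda>x. indicator Q x * f x)" if "Q \<in> D n" for Q
    using integrable_mult_indicator[OF events_D[OF that] f] by simp
  have "expectation f = expectation (\<lambda>x. \<Sum>Q\<in>D n. indicator Q x * f x)"
  proof (rule Bochner_Integration.integral_cong[OF refl])
    fix x assume x: "x \<in> space M"
    show "f x = (\<Sum>Q\<in>D n. indicator Q x * f x)"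
      using sum_indicator_cell[OF x, of "\<lambda>_. f x" n] by (simp add: mult.commute)
  qed
  then show ?thesis using int by simp
qed

lemma expectation_on_cell:
  assumes Q: "Q \<in> D n" and F: "\<And>R x. R \<in> children n l Q \<Longrightarrow> x \<in> R \<Longrightarrow> f x = F R"
  shows "expectation (\<lambda>x. indicator Q x * f x) = (\<Sum>R\<in>children n l Q. F R * prob R)"
proof -
  have ev: "R \<in> events" if "R \<in> children n l Q" for R
    using that by (auto simp: children_def intro: events_D)
  have "expectation (\<lambda>x. indicator Q x * f x)
      = expectation (\<lambda>x. \<Sum>R\<in>children n l Q. F R * indicator R x)"
  proof (rule Bochner_Integration.integral_cong[OF refl])
    fix x assume x: "x \<in> space M"
    show "indicator Q x * f x = (\<Sum>R\<in>children n l Q. F R * indicator R x)"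
    proof (cases "x \<in> Q")
      case True
      then have Qx: "cell n x = Q" by (rule cell_eq[OF Q])
      let ?S = "cell (n + l) x"
      have S: "?S \<in> children n l Q" "x \<in> ?S" using cell_children[OF x, of n l] cell_mem[OF x] Qx by auto
      have "(\<Sum>R\<in>children n l Q. F R * indicator R x)
          = (\<Sum>R\<in>children n l Q. if R = ?S then F R else 0)"
        using S by (intro sum.cong) (auto simp: indicator_def children_def dest: cell_eq)
      also have "\<dots> = F ?S" using S finite_children by simp
      finally show ?thesis using F[OF S] True by simp
    next
      case False
      then show ?thesis by (auto simp: children_def indicator_def intro!: sum.neutral)
    qed
  qed
  also have "\<dots> = (\<Sum>R\<in>children n l Q. F R * prob R)"
    using ev by (subst Bochner_Integration.integral_sum) (auto simp: emeasure_eq_measure)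
  finally show ?thesis .
qed

lemma sum_prob_children: "Q \<in> D n \<Longrightarrow> (\<Sum>R\<in>children n l Q. prob R) = prob Q"
  using expectation_on_cell[of Q n l "\<lambda>_. 1" "\<lambda>_. 1"] by (simp add: events_D)

lemma prob_child_le: "Q \<in> D n \<Longrightarrow> R \<in> children n l Q \<Longrightarrow> prob R \<le> prob Q"
  by (auto simp: children_def intro: finite_measure_mono events_D)

text \<open>The last identity survives \<open>prob Q = 0\<close>, where the conditional vector is identically zero: then the
  child is a null set too.\<close>

lemma conditional_vector_bounds:
  assumes "Q \<in> D n" "R \<in> children n l Q"
  shows "0 \<le> conditional_vector M Q R" "conditional_vector M Q R \<le> 1"
    and "prob R = prob Q * conditional_vector M Q R"
proof -
  have le: "prob R \<le> prob Q" by (rule prob_child_le[OF assms])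
  show "0 \<le> conditional_vector M Q R" by (simp add: conditional_vector_def)
  show "conditional_vector M Q R \<le> 1"
    using le by (simp add: conditional_vector_def divide_le_eq_1 measure_nonneg less_le)
  show "prob R = prob Q * conditional_vector M Q R"
    using le by (auto simp: conditional_vector_def intro: antisym)
qed

lemma vector_entropy_bounds:
  assumes "Q \<in> D n"
  shows "0 \<le> vector_entropy (children n l Q) (conditional_vector M Q)"
    and "vector_entropy (children n l Q) (conditional_vector M Q) \<le> 2 * real (B l)"
proof -
  note bds = conditional_vector_bounds[OF assms]
  show "0 \<le> vector_entropy (children n l Q) (conditional_vector M Q)"
    unfolding vector_entropy_def by (intro sum_nonneg entropy_term_bounds bds)
  have "vector_entropy (children n l Q) (conditional_vector M Q) \<le> real (card (children n l Q)) * 2"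
    unfolding vector_entropy_def by (intro sum_bounded_above entropy_term_bounds bds)
  also have "\<dots> \<le> 2 * real (B l)" using card_children[OF assms, of l] by simp
  finally show "vector_entropy (children n l Q) (conditional_vector M Q) \<le> 2 * real (B l)" .
qed

lemma entropy_at_bounds:
  "x \<in> space M \<Longrightarrow> 0 \<le> entropy_at l n x" "x \<in> space M \<Longrightarrow> entropy_at l n x \<le> 2 * real (B l)"
  unfolding entropy_at_def by (auto intro: vector_entropy_bounds cell_mem)

text \<open>On a null cell the logarithm is taken at \<open>0\<close>, where it has the value \<open>0\<close>; elsewhere its argument is
  a ratio in \<open>(0, 1]\<close>.\<close>

lemma information_gain_nonneg:
  assumes "x \<in> space M"
  shows "0 \<le> information_gain l n x"
proof -
  note bds = conditional_vector_bounds[OF cell_mem(1)[OF assms] cell_children[OF assms], of n l]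
  show ?thesis
    using bds(1,2) unfolding information_gain_def
    by (cases "conditional_vector M (cell n x) (cell (n + l) x) = 0") (simp add: log_def, auto)
qed

lemma cellwise_entropy_at: "cellwise n (entropy_at l n)"
  by (rule cellwiseI[where F = "\<lambda>Q. vector_entropy (children n l Q) (conditional_vector M Q)"])
    (simp add: entropy_at_def)

lemma cellwise_information_gain: "cellwise (n + l) (information_gain l n)"
proof (rule cellwiseI[where F = "\<lambda>R. - log 2 (conditional_vector M (cell n (SOME y. y \<in> R)) R)"])
  fix x assume x: "x \<in> space M"
  have "(SOME y. y \<in> cell (n + l) x) \<in> cell (n + l) x"
    using cell_mem(2)[OF x] by (rule someI)
  with cell_mono[OF x, of n "n + l"] have "(SOME y. y \<in> cell (n + l) x) \<in> cell n x" by auto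
  then have "cell n (SOME y. y \<in> cell (n + l) x) = cell n x"
    using cell_mem(1)[OF x] by (rule cell_eq[rotated])
  then show "information_gain l n x
      = - log 2 (conditional_vector M (cell n (SOME y. y \<in> cell (n + l) x)) (cell (n + l) x))"
    by (simp add: information_gain_def)
qed

text \<open>Entropy is the conditional mean of the information gain. This is the identity that brings \<open>H\<close> into
  the problem.\<close>

lemma expectation_excess_on_cell:
  assumes Q: "Q \<in> D n"
  shows "expectation (\<lambda>x. indicator Q x * (information_gain l n x - entropy_at l n x)) = 0"
proof -
  let ?p = "conditional_vector M Q" and ?H = "vector_entropy (children n l Q) (conditional_vector M Q)"
  have "expectation (\<lambda>x. indicator Q x * (information_gain l n x - entropy_at l n x))
      = (\<Sum>R\<in>children n l Q. (- log 2 (?p R) - ?H) * prob R)"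
    by (rule expectation_on_cell[OF Q])
      (simp add: information_gain_def entropy_at_def cell_of_child[OF Q])
  also have "\<dots> = (\<Sum>R\<in>children n l Q. prob Q * (- ?p R * log 2 (?p R)) - ?H * prob R)"
    by (intro sum.cong refl) (simp add: conditional_vector_bounds(3)[OF Q] algebra_simps)
  also have "\<dots> = prob Q * ?H - ?H * prob Q"
    unfolding sum_subtractf sum_distrib_left[symmetric] sum_prob_children[OF Q]
    by (simp only: vector_entropy_def)
  finally show ?thesis by simp
qed

text \<open>On each cell the second moment is its mass times a sum of at most \<open>B l\<close> terms
  \<open>p (log p)\<^sup>2\<close>.\<close>

lemma expectation_information_gain_square:
  "expectation (\<lambda>x. (information_gain l n x)\<^sup>2) \<le> 16 * real (B l)"
proof -
  have int: "integrable M (\<lambda>x. (information_gain l n x)\<^sup>2)"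
    unfolding power2_eq_square
    by (rule cellwise_integrable, rule cellwise_mult; rule cellwise_information_gain)
  have cell: "expectation (\<lambda>x. indicator Q x * (information_gain l n x)\<^sup>2) \<le> 16 * real (B l) * prob Q"
    if Q: "Q \<in> D n" for Q
  proof -
    let ?p = "conditional_vector M Q"
    have "expectation (\<lambda>x. indicator Q x * (information_gain l n x)\<^sup>2)
        = (\<Sum>R\<in>children n l Q. (log 2 (?p R))\<^sup>2 * prob R)"
      by (rule expectation_on_cell[OF Q]) (simp add: information_gain_def cell_of_child[OF Q])
    also have "\<dots> = prob Q * (\<Sum>R\<in>children n l Q. ?p R * (log 2 (?p R))\<^sup>2)"
      unfolding sum_distrib_left
      by (intro sum.cong refl) (simp add: conditional_vector_bounds(3)[OF Q])
    also have "\<dots> \<le> prob Q * (real (card (children n l Q)) * 16)"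
      by (intro mult_left_mono sum_bounded_above entropy_term_bounds conditional_vector_bounds[OF Q]) auto
    also have "\<dots> \<le> prob Q * (real (B l) * 16)"
      using card_children[OF Q, of l] by (intro mult_left_mono mult_right_mono) auto
    finally show ?thesis by (simp add: mult.commute mult.left_commute)
  qed
  have "expectation (\<lambda>x. (information_gain l n x)\<^sup>2)
      = (\<Sum>Q\<in>D n. expectation (\<lambda>x. indicator Q x * (information_gain l n x)\<^sup>2))"
    by (rule expectation_split_cells[OF int])
  also have "\<dots> \<le> (\<Sum>Q\<in>D n. 16 * real (B l) * prob Q)" by (intro sum_mono cell)
  also have "\<dots> = 16 * real (B l) * (\<Sum>Q\<in>D n. prob Q)" by (simp add: sum_distrib_left)
  also have "(\<Sum>Q\<in>D n. prob Q) = 1"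
    using expectation_split_cells[of "\<lambda>_. 1" n] prob_space by (simp add: events_D)
  finally show ?thesis by simp
qed

lemma AE_average_information_gain:
  "AE x in M. (\<lambda>n. (\<Sum>i=1..n. information_gain l i x - entropy_at l i x) / real n) \<longlonglongrightarrow> 0"
proof (rule AE_averages_of_finite_range_orthogonal)
  let ?X = "\<lambda>i x. information_gain l i x - entropy_at l i x"
  have cw: "cellwise (i + l) (?X i)" for i
    by (intro cellwise_diff cellwise_information_gain cellwise_mono[OF cellwise_entropy_at]) simp
  show "?X i \<in> borel_measurable M" for i
    using cellwise_integrable[OF cw] by (rule borel_measurable_integrable)
  show int: "integrable M (\<lambda>x. ?X i x * ?X j x)" for i j
    by (rule cellwise_integrable[of "max (i + l) (j + l)"], rule cellwise_mult; rule cellwise_mono[OF cw]) auto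
  show "expectation (\<lambda>x. ?X i x * ?X j x) = 0" if "i + l \<le> j" for i j
    by (rule integral_cellwise_mult[OF cellwise_mono[OF cw that] cellwise_integrable[OF cw]])
      (rule expectation_excess_on_cell)
  show "- (2 * real (B l)) \<le> ?X i x" if "x \<in> space M" for i x
    using information_gain_nonneg[OF that, of l i] entropy_at_bounds(2)[OF that, of l i] by simp
  show "expectation (\<lambda>x. (?X i x)\<^sup>2) \<le> 2 * (16 * real (B l)) + 2 * (2 * real (B l))\<^sup>2" for i
  proof -
    have int': "integrable M (\<lambda>x. (information_gain l i x)\<^sup>2)"
      unfolding power2_eq_square
      by (rule cellwise_integrable, rule cellwise_mult; rule cellwise_information_gain)
    have "expectation (\<lambda>x. (?X i x)\<^sup>2)
        \<le> expectation (\<lambda>x. 2 * (information_gain l i x)\<^sup>2 + 2 * (2 * real (B l))\<^sup>2)"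
    proof (rule integral_mono)
      fix x assume x: "x \<in> space M"
      let ?a = "information_gain l i x" and ?b = "entropy_at l i x"
      have "0 \<le> (?a + ?b)\<^sup>2" by simp
      then have "(?X i x)\<^sup>2 \<le> 2 * ?a\<^sup>2 + 2 * ?b\<^sup>2"
        unfolding power2_sum power2_diff by linarith
      moreover have "?b\<^sup>2 \<le> (2 * real (B l))\<^sup>2"
        using entropy_at_bounds[OF x, of l i] by (intro power_mono) auto
      ultimately show "(?X i x)\<^sup>2 \<le> 2 * ?a\<^sup>2 + 2 * (2 * real (B l))\<^sup>2" by linarith
    next
      show "integrable M (\<lambda>x. (?X i x)\<^sup>2)" using int[of i i] by (simp add: power2_eq_square)
    next
      show "integrable M (\<lambda>x. 2 * (information_gain l i x)\<^sup>2 + 2 * (2 * real (B l))\<^sup>2)"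
        using int' by simp
    qed
    also have "\<dots> = 2 * expectation (\<lambda>x. (information_gain l i x)\<^sup>2) + 2 * (2 * real (B l))\<^sup>2"
      using int' by (simp add: prob_space)
    finally show ?thesis using expectation_information_gain_square[of l i] by linarith
  qed
qed simp

lemma AE_cell_prob_pos: "AE x in M. \<forall>n. 0 < prob (cell n x)"
  unfolding AE_all_countable
proof
  fix n
  have "AE x in M. \<forall>Q\<in>D n. prob Q = 0 \<longrightarrow> x \<notin> Q"
  proof (rule AE_finite_allI[OF finite_D])
    fix Q assume "Q \<in> D n"
    show "AE x in M. prob Q = 0 \<longrightarrow> x \<notin> Q"
    proof (cases "prob Q = 0")
      case True
      then have "Q \<in> null_sets M" using events_D[OF \<open>Q \<in> D n\<close>] by (auto simp: emeasure_eq_measure null_sets_def)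
      from AE_not_in[OF this] show ?thesis by simp
    qed simp
  qed
  then show "AE x in M. 0 < prob (cell n x)"
  proof (rule AE_mp, intro AE_I2 impI)
    fix x assume x: "x \<in> space M" and "\<forall>Q\<in>D n. prob Q = 0 \<longrightarrow> x \<notin> Q"
    then show "0 < prob (cell n x)"
      using cell_mem[OF x, of n] by (auto simp: zero_less_measure_iff)
  qed
qed

text \<open>A cell that is light compared with its associated set \<open>N n R\<close> is unlikely to be hit: the light
  cells have total mass at most \<open>2 powr (- e n)\<close> times the sum of the masses of the sets \<open>N n R\<close>,
  and that sum is at most the overlap number \<open>K\<close>. Borel--Cantelli then applies for each fixed \<open>e\<close>, and
  countably many \<open>e\<close> suffice. The level \<open>lev n\<close> may differ from \<open>n\<close> so that \<open>N n R\<close> can be an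
  ancestor of \<open>R\<close>.\<close>

lemma AE_neighbourhood_prob_le:
  fixes N :: "nat \<Rightarrow> 'a set \<Rightarrow> 'a set"
  assumes N: "\<And>n R. R \<in> D (lev n) \<Longrightarrow> N n R \<in> events"
    and overlap: "\<And>n y. y \<in> space M \<Longrightarrow> card {R \<in> D (lev n). y \<in> N n R} \<le> K"
  shows "AE x in M. \<forall>e>0. eventually (\<lambda>n. prob (N n (cell (lev n) x))
           \<le> 2 powr (e * real n) * prob (cell (lev n) x)) sequentially"
proof -
  have *: "AE x in M. eventually (\<lambda>n. prob (N n (cell (lev n) x))
           \<le> 2 powr (e * real n) * prob (cell (lev n) x)) sequentially" if e: "0 < e" for e
  proof -
    define bad where "bad n = {R \<in> D (lev n). 2 powr (e * real n) * prob R < prob (N n R)}" for n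
    have fin: "finite (bad n)" for n using finite_D by (simp add: bad_def)
    have ev: "\<Union>(bad n) \<in> events" for n
      using fin by (intro sets.finite_Union) (auto simp: bad_def intro: events_D)
    have bad_le: "norm (prob (\<Union>(bad n))) \<le> (2 powr (- e)) ^ n * real K" for n
    proof -
      have "prob (\<Union>(bad n)) \<le> (\<Sum>R\<in>bad n. prob R)"
        using finite_measure_subadditive_finite[OF fin, of "\<lambda>R. R"] 
        by (auto simp: bad_def intro: events_D)
      also have "\<dots> \<le> (\<Sum>R\<in>bad n. 2 powr (- e * real n) * prob (N n R))"
      proof (rule sum_mono)
        fix R assume "R \<in> bad n"
        then have "2 powr (- e * real n) * (2 powr (e * real n) * prob R) \<le> 2 powr (- e * real n) * prob (N n R)"
          by (intro mult_left_mono) (auto simp: bad_def)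
        then show "prob R \<le> 2 powr (- e * real n) * prob (N n R)"
          by (simp add: mult.assoc[symmetric] powr_add[symmetric])
      qed
      also have "\<dots> \<le> (\<Sum>R\<in>D (lev n). 2 powr (- e * real n) * prob (N n R))"
        by (intro sum_mono2 finite_D) (auto simp: bad_def)
      also have "\<dots> = 2 powr (- e * real n) * (\<Sum>R\<in>D (lev n). prob (N n R))"
        by (simp add: sum_distrib_left)
      also have "(\<Sum>R\<in>D (lev n). prob (N n R)) = expectation (\<lambda>y. \<Sum>R\<in>D (lev n). indicator (N n R) y)"
        using N by (subst Bochner_Integration.integral_sum) (auto simp: emeasure_eq_measure)
      also have "\<dots> \<le> expectation (\<lambda>y. real K)"
      proof (rule integral_mono)
        show "integrable M (\<lambda>y. \<Sum>R\<in>D (lev n). indicator (N n R) y :: real)"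
          using N by (auto simp: emeasure_eq_measure)
        fix y assume y: "y \<in> space M"
        have "(\<Sum>R\<in>D (lev n). indicator (N n R) y) = real (card {R \<in> D (lev n). y \<in> N n R})"
          using finite_D by (simp add: indicator_def sum.If_cases Int_def)
        then show "(\<Sum>R\<in>D (lev n). indicator (N n R) y) \<le> real K" using overlap[OF y] by simp
      qed simp
      also have "expectation (\<lambda>y. real K) = real K" by (simp add: prob_space)
      also have "2 powr (- e * real n) = (2 powr (- e)) ^ n"
        using powr_powr[of 2 "- e" "real n"] powr_realpow[of "2 powr (- e)" n] by simp
      finally show ?thesis by (simp add: mult_left_mono)
    qed
    have "2 powr (- e) < 1"
      using powr_less_mono[of "- e" 0 2] e by simp
    then have "summable (\<lambda>n. (2 powr (- e)) ^ n * real K)"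
      by (intro summable_mult2 summable_geometric) simp
    then have "summable (\<lambda>n. prob (\<Union>(bad n)))"
      by (rule summable_comparison_test'[where N = 0]) (rule bad_le)
    then have "AE x in M. eventually (\<lambda>n. x \<in> space M - \<Union>(bad n)) sequentially"
      using ev by (intro borel_cantelli_AE1) (auto simp: emeasure_eq_measure)
    then show ?thesis
    proof (rule AE_mp, intro AE_I2 impI)
      fix x assume x: "x \<in> space M" and "eventually (\<lambda>n. x \<in> space M - \<Union>(bad n)) sequentially"
      from this(2) show "eventually (\<lambda>n. prob (N n (cell (lev n) x))
           \<le> 2 powr (e * real n) * prob (cell (lev n) x)) sequentially"
      proof eventually_elim
        case (elim n)
        then show ?case using cell_mem[OF x, of "lev n"] by (auto simp: bad_def not_less)
      qed
    qed
  qed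
  \<comment> \<open>The exceptional null set depends on \<open>e\<close>; the values \<open>1 / (k + 1)\<close> make it uniform.\<close>
  have "AE x in M. \<forall>k. eventually (\<lambda>n. prob (N n (cell (lev n) x))
           \<le> 2 powr (inverse (real (Suc k)) * real n) * prob (cell (lev n) x)) sequentially"
    unfolding AE_all_countable by (intro allI *) simp
  then show ?thesis
  proof (rule AE_mp, intro AE_I2 impI allI)
    fix x and e :: real
    assume k: "\<forall>k. eventually (\<lambda>n. prob (N n (cell (lev n) x))
           \<le> 2 powr (inverse (real (Suc k)) * real n) * prob (cell (lev n) x)) sequentially"
      and "0 < e"
    obtain k where "inverse (real (Suc k)) < e" using reals_Archimedean[OF \<open>0 < e\<close>] by auto
    then have "2 powr (inverse (real (Suc k)) * real n) * prob (cell (lev n) x)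
        \<le> 2 powr (e * real n) * prob (cell (lev n) x)" for n
      by (intro mult_right_mono powr_mono) auto
    then show "eventually (\<lambda>n. prob (N n (cell (lev n) x))
           \<le> 2 powr (e * real n) * prob (cell (lev n) x)) sequentially"
      using k[rule_format, of k] by (auto elim!: eventually_mono intro: order_trans)
  qed
qed

text \<open>Here the set attached to a cell of level \<open>n + j\<close> is its ancestor of level \<open>n\<close>. A point lies in
  the ancestors of at most \<open>B j\<close> cells.\<close>

lemma AE_information_gain_sublinear:
  "AE x in M. \<forall>j. (\<lambda>n. information_gain j n x / real n) \<longlonglongrightarrow> 0"
  unfolding AE_all_countable
proof
  fix j
  \<comment> \<open>For a nonempty cell \<open>R\<close> of level at least \<open>n\<close> all sets in this union are equal to its ancestor.\<close>
  define N where "N n R = (\<Union>x\<in>R. cell n x)" for n R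
  have events_N: "N n R \<in> events" if R: "R \<in> D (n + j)" for n R
  proof -
    have "N n R = \<Union>(cell n ` R)" by (simp add: N_def)
    moreover have "cell n ` R \<subseteq> D n" using subset_space_D[OF R] cell_mem by blast
    ultimately show "N n R \<in> events"
      using finite_subset[OF _ finite_D] events_D by (auto intro!: sets.finite_Union)
  qed
  have "AE x in M. \<forall>e>0. eventually (\<lambda>n. prob (N n (cell (n + j) x))
           \<le> 2 powr (e * real n) * prob (cell (n + j) x)) sequentially"
  proof (rule AE_neighbourhood_prob_le[OF events_N])
    fix n y assume y: "y \<in> space M"
    have "{R \<in> D (n + j). y \<in> N n R} \<subseteq> children n j (cell n y)"
    proof safe
      fix R assume R: "R \<in> D (n + j)" and "y \<in> N n R"
      then obtain x where x: "x \<in> R" "y \<in> cell n x" by (auto simp: N_def)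
      have xs: "x \<in> space M" using subset_space_D[OF R] x by auto
      have "cell n y = cell n x" using cell_eq[OF cell_mem(1)[OF xs] x(2)] .
      moreover have "cell (n + j) x = R" using cell_eq[OF R x(1)] .
      ultimately show "R \<in> children n j (cell n y)" using cell_children[OF xs, of n j] by simp
    qed
    then have "card {R \<in> D (n + j). y \<in> N n R} \<le> card (children n j (cell n y))"
      by (intro card_mono finite_children)
    also have "\<dots> \<le> B j" by (intro card_children cell_mem y)
    finally show "card {R \<in> D (n + j). y \<in> N n R} \<le> B j" .
  qed
  then show "AE x in M. (\<lambda>n. information_gain j n x / real n) \<longlonglongrightarrow> 0"
    using AE_cell_prob_pos AE_space
  proof eventually_elim
    case (elim x)
    have small: "eventually (\<lambda>n. information_gain j n x \<le> e * real n) sequentially" if "0 < e" for e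
      using elim(1)[rule_format, OF that]
    proof eventually_elim
      case (elim n)
      let ?P = "prob (cell n x)" and ?C = "prob (cell (n + j) x)"
      have pos: "0 < ?P" "0 < ?C" using \<open>\<forall>n. 0 < prob (cell n x)\<close> by auto
      have R: "cell (n + j) x \<in> D (n + j)" "x \<in> cell (n + j) x" using cell_mem[OF \<open>x \<in> space M\<close>] by auto
      have "N n (cell (n + j) x) \<in> events"
        using events_N[OF R(1)] .
      moreover have "cell n x \<subseteq> N n (cell (n + j) x)" using R(2) by (auto simp: N_def)
      ultimately have "?P \<le> 2 powr (e * real n) * ?C"
        using elim by (meson finite_measure_mono order_trans)
      then have "log 2 ?P \<le> log 2 (2 powr (e * real n) * ?C)"
        using pos by (subst log_le_cancel_iff) auto
      also have "\<dots> = e * real n + log 2 ?C" using pos by (subst log_mult) auto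
      finally show ?case
        using pos by (simp add: information_gain_def conditional_vector_def log_divide)
    qed
    show ?case
      unfolding tendsto_iff
    proof (intro allI impI)
      fix e :: real assume e: "0 < e"
      from small[of "e / 2"] e
      have "eventually (\<lambda>n. information_gain j n x \<le> e / 2 * real n) sequentially" by simp
      then show "eventually (\<lambda>n. dist (information_gain j n x / real n) 0 < e) sequentially"
        using eventually_gt_at_top[of 0]
      proof eventually_elim
        case (elim n)
        have "0 < e * real n" using elim e by simp
        then have "information_gain j n x < e * real n"
          using elim by linarith
        then show ?case
          using information_gain_nonneg[OF \<open>x \<in> space M\<close>, of j n] elim
          by (simp add: pos_divide_less_eq)
      qed
    qed
  qed
qed

text \<open>Both sides equal \<open>g (n + 1) + \<dots> + g (n + l)\<close> minus \<open>g 1 + \<dots> + g l\<close>. The form on the right isolates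
  the main term \<open>l g n\<close>.\<close>

lemma sum_shift_difference:
  fixes g :: "nat \<Rightarrow> real"
  shows "(\<Sum>i=1..n. g (i + l) - g i) = (\<Sum>j=1..l. g (n + j) - g n) + real l * g n - (\<Sum>j=1..l. g j)"
proof -
  have step: "(\<Sum>j=1..l. g (Suc n + j)) = (\<Sum>j=1..l. g (n + j)) + g (Suc n + l) - g (Suc n)" for n
    by (induction l) auto
  have "(\<Sum>i=1..n. g (i + l) - g i) = (\<Sum>j=1..l. g (n + j)) - (\<Sum>j=1..l. g j)"
  proof (induction n)
    case (Suc n)
    then show ?case unfolding step by simp
  qed simp
  then show ?thesis by (simp add: sum_subtractf)
qed

theorem AE_log_cell_prob_entropy_averages:
  assumes l: "l \<ge> 1"
  shows "AE x in M. (\<lambda>n. 1 / real n * (- log 2 (prob (cell n x))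
           - 1 / real l * (\<Sum>i=1..n. entropy_at l i x))) \<longlonglongrightarrow> 0"
  using AE_average_information_gain[of l] AE_information_gain_sublinear AE_cell_prob_pos
proof eventually_elim
  case (elim x)
  define g where "g n = - log 2 (prob (cell n x))" for n
  have gain: "information_gain j n x = g (n + j) - g n" for j n
    using elim(3)[rule_format, of "n + j"] elim(3)[rule_format, of n]
    by (simp add: information_gain_def conditional_vector_def g_def log_divide_pos)
  have lim: "(\<lambda>n. ((\<Sum>i=1..n. information_gain l i x - entropy_at l i x) / real n
      - (\<Sum>j=1..l. (g (n + j) - g n) / real n) + (\<Sum>j=1..l. g j) / real n) / real l) \<longlonglongrightarrow> (0 - (\<Sum>j=1..l. 0) + 0) / real l"
    using elim(1,2) l unfolding gain
    by (intro tendsto_intros lim_const_over_n) auto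
  have eq: "((\<Sum>i=1..n. information_gain l i x - entropy_at l i x) / real n
      - (\<Sum>j=1..l. (g (n + j) - g n) / real n) + (\<Sum>j=1..l. g j) / real n) / real l
      = 1 / real n * (g n - 1 / real l * (\<Sum>i=1..n. entropy_at l i x))" for n
  proof -
    define E where "E = (\<Sum>i=1..n. entropy_at l i x)"
    define T where "T = (\<Sum>j=1..l. g (n + j) - g n)"
    have T: "(\<Sum>j=1..l. (g (n + j) - g n) / real n) = T / real n"
      unfolding T_def by (rule sum_divide_distrib[symmetric])
    have "(\<Sum>i=1..n. information_gain l i x - entropy_at l i x) = (\<Sum>i=1..n. g (i + l) - g i) - E"
      unfolding E_def gain by (rule sum_subtractf)
    then have I: "(\<Sum>i=1..n. information_gain l i x - entropy_at l i x) = T + real l * g n - (\<Sum>j=1..l. g j) - E"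
      unfolding sum_shift_difference T_def by simp
    have alg: "((T + L * G - S - E) / N - T / N + S / N) / L = 1 / N * (G - 1 / L * E)"
      if "L \<noteq> 0" for T L G S E N :: real
    proof -
      have "(T + L * G - S - E) / N - T / N + S / N = (L * G - E) / N"
        unfolding add_divide_distrib[symmetric] diff_divide_distrib[symmetric] by simp
      also have "L * G - E = L * (G - 1 / L * E)"
        using that by (simp add: right_diff_distrib)
      finally show ?thesis using that by simp
    qed
    show ?thesis
      unfolding I T E_def[symmetric] by (rule alg) (use l in simp)
  qed
  from lim have "(\<lambda>n. 1 / real n * (g n - 1 / real l * (\<Sum>i=1..n. entropy_at l i x))) \<longlonglongrightarrow> 0"
    unfolding eq by simp
  then show ?case by (simp only: g_def)
qed

end
section \<open>Dyadic cubes as nested partitions\<close>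


definition half_open_unit_cube :: "(real ^ 'd) set" where
  "half_open_unit_cube = {x. \<forall>i. 0 \<le> x $ i \<and> x $ i < 1}"

definition dyadic_box :: "nat \<Rightarrow> ('d \<Rightarrow> nat) \<Rightarrow> (real ^ 'd) set" where
  "dyadic_box n j = {x. \<forall>i. x $ i \<in> {real (j i) / 2 ^ n ..< (real (j i) + 1) / 2 ^ n}}"

lemma dyadic_cubes_eq_image: "dyadic_cubes n = dyadic_box n ` {j. \<forall>i. j i < 2 ^ n}"
  by (auto simp: dyadic_cubes_def dyadic_box_def)

text \<open>Membership through integer parts turns all questions about nesting into integer division.\<close>

lemma mem_dyadic_box: "x \<in> dyadic_box n j \<longleftrightarrow> (\<forall>i. \<lfloor>2 ^ n * x $ i\<rfloor> = int (j i))"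
  by (simp add: dyadic_box_def floor_eq_iff field_simps)

lemma dyadic_box_nonempty: "dyadic_box n j \<noteq> {}"
proof -
  have "(\<chi> i. real (j i) / 2 ^ n) \<in> dyadic_box n j"
    by (simp add: dyadic_box_def divide_strict_right_mono)
  then show ?thesis by blast
qed

lemma dyadic_box_unique: "x \<in> dyadic_box n j \<Longrightarrow> x \<in> dyadic_box n k \<Longrightarrow> j = k"
  by (auto simp: mem_dyadic_box fun_eq_iff)

lemma floor_coarser_dyadic:
  fixes t :: real
  assumes "m \<le> n"
  shows "\<lfloor>2 ^ m * t\<rfloor> = \<lfloor>2 ^ n * t\<rfloor> div 2 ^ (n - m)"
proof -
  have "(2::real) ^ n = 2 ^ m * 2 ^ (n - m)" using assms by (simp add: power_add[symmetric])
  then have "2 ^ m * t = (2 ^ n * t) / real_of_int (2 ^ (n - m))" by simp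
  then show ?thesis by (simp only: floor_divide_real_eq_div zero_le_power zero_le_numeral)
qed

lemma finite_card_bounded_functions:
  fixes A :: "'d::finite \<Rightarrow> nat set"
  assumes "\<And>i. finite (A i)" "\<And>i. card (A i) \<le> c"
  shows "finite {j. \<forall>i. j i \<in> A i}" "card {j. \<forall>i. j i \<in> A i} \<le> c ^ CARD('d)"
proof -
  have eq: "{j. \<forall>i. j i \<in> A i} = (\<Pi>\<^sub>E i\<in>UNIV. A i)" by (auto simp: PiE_UNIV_domain)
  show "finite {j. \<forall>i. j i \<in> A i}" unfolding eq by (intro finite_PiE assms) simp
  have "card {j. \<forall>i. j i \<in> A i} = (\<Prod>i\<in>UNIV. card (A i))"
    unfolding eq by (simp add: card_PiE)
  also have "\<dots> \<le> (\<Prod>i\<in>(UNIV :: 'd set). c)" by (intro prod_mono) (simp add: assms)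
  finally show "card {j. \<forall>i. j i \<in> A i} \<le> c ^ CARD('d)" by simp
qed

lemma finite_dyadic_cubes: "finite (dyadic_cubes n :: (real ^ 'd) set set)"
  using finite_card_bounded_functions(1)[of "\<lambda>_::'d. {..<2 ^ n}" "2 ^ n"]
  by (simp add: dyadic_cubes_eq_image)

lemma coordinate_box_borel:
  fixes S :: "'d::finite \<Rightarrow> real set"
  assumes "\<And>i. S i \<in> sets borel"
  shows "{x :: real ^ 'd. \<forall>i. x $ i \<in> S i} \<in> sets borel"
proof -
  have "{x :: real ^ 'd. \<forall>i. x $ i \<in> S i} = (\<Inter>i. (\<lambda>x. x $ i) -` S i \<inter> space borel)" by auto
  also have "\<dots> \<in> sets borel"
    by (intro sets.finite_INT measurable_sets[OF borel_measurable_continuous_onI] assms)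
      (auto intro: continuous_intros)
  finally show ?thesis .
qed

lemma dyadic_cube_borel: "Q \<in> dyadic_cubes n \<Longrightarrow> Q \<in> sets borel"
  by (auto simp: dyadic_cubes_def intro: coordinate_box_borel)

lemma half_open_unit_cube_borel: "half_open_unit_cube \<in> sets borel"
  using coordinate_box_borel[of "\<lambda>_. {0..<1}"] by (simp add: half_open_unit_cube_def)

lemma dyadic_cube_subset:
  assumes "Q \<in> dyadic_cubes n"
  shows "Q \<subseteq> half_open_unit_cube"
proof
  fix x assume "x \<in> Q"
  then obtain j where j: "\<And>i. j i < (2::nat) ^ n" and x: "x \<in> dyadic_box n j"
    using assms by (auto simp: dyadic_cubes_eq_image)
  have "0 \<le> x $ i \<and> x $ i < 1" for i
  proof -
    have "real (j i) / 2 ^ n \<le> x $ i" "x $ i < (real (j i) + 1) / 2 ^ n"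
      using x by (auto simp: dyadic_box_def)
    moreover have "0 \<le> real (j i) / 2 ^ n" by simp
    moreover have "real (j i + 1) \<le> real (2 ^ n)"
      using j[of i] by (subst of_nat_le_iff) simp
    then have "(real (j i) + 1) / 2 ^ n \<le> 1" by simp
    ultimately show ?thesis by linarith
  qed
  then show "x \<in> half_open_unit_cube" by (simp add: half_open_unit_cube_def)
qed

lemma dyadic_cubes_cover:
  assumes "x \<in> half_open_unit_cube"
  shows "\<exists>Q\<in>dyadic_cubes n. x \<in> Q"
proof -
  define j where "j i = nat \<lfloor>2 ^ n * x $ i\<rfloor>" for i
  have x: "0 \<le> x $ i" "x $ i < 1" for i using assms by (auto simp: half_open_unit_cube_def)
  have "x \<in> dyadic_box n j" by (simp add: mem_dyadic_box j_def x)
  moreover have "j i < 2 ^ n" for i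
  proof -
    have "2 ^ n * x $ i < 2 ^ n * 1" using x by (intro mult_strict_left_mono) auto
    then have "\<lfloor>2 ^ n * x $ i\<rfloor> < 2 ^ n" by (simp add: floor_less_iff)
    then show ?thesis using x[of i] by (simp add: j_def nat_less_iff)
  qed
  ultimately show ?thesis by (auto simp: dyadic_cubes_eq_image)
qed

text \<open>The index of a subcube is determined coordinatewise by its \<open>l\<close> lowest binary digits.\<close>

lemma card_subcubes_le:
  assumes "Q \<in> dyadic_cubes n"
  shows "card (subcubes n l (Q :: (real ^ 'd) set)) \<le> 2 ^ (l * CARD('d))"
proof -
  obtain q where q: "Q = dyadic_box n q" using assms by (auto simp: dyadic_cubes_eq_image)
  let ?A = "\<lambda>i. {q i * 2 ^ l ..< q i * 2 ^ l + 2 ^ l}"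
  have "subcubes n l Q \<subseteq> dyadic_box (n + l) ` {j. \<forall>i. j i \<in> ?A i}"
  proof
    fix R assume "R \<in> subcubes n l Q"
    then obtain j where R: "R = dyadic_box (n + l) j" "R \<subseteq> Q"
      by (auto simp: subcubes_def dyadic_cubes_eq_image)
    obtain x where x: "x \<in> R" using R dyadic_box_nonempty by blast
    have "j i \<in> ?A i" for i
    proof -
      have "int (q i) = int (j i) div 2 ^ l"
        using floor_coarser_dyadic[of n "n + l" "x $ i"] x subsetD[OF R(2) x] unfolding R q mem_dyadic_box
        by simp
      then have "int (q i) = int (j i div 2 ^ l)" by (simp add: zdiv_int)
      then have "q i = j i div 2 ^ l" by linarith
      then have "j i = q i * 2 ^ l + j i mod 2 ^ l" by (simp only: div_mult_mod_eq)
      moreover have "j i mod 2 ^ l < 2 ^ l" by simp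
      ultimately show ?thesis unfolding atLeastLessThan_iff by linarith
    qed
    then show "R \<in> dyadic_box (n + l) ` {j. \<forall>i. j i \<in> ?A i}" using R by blast
  qed
  moreover note fin = finite_card_bounded_functions[of ?A "2 ^ l"]
  ultimately have "card (subcubes n l Q) \<le> card (dyadic_box (n + l) ` {j. \<forall>i. j i \<in> ?A i})"
    by (intro card_mono finite_imageI fin) auto
  also have "\<dots> \<le> card {j. \<forall>i. j i \<in> ?A i}" by (intro card_image_le fin) auto
  also have "\<dots> \<le> (2 ^ l) ^ CARD('d)" by (intro fin) auto
  finally show ?thesis by (simp add: power_mult)
qed

lemma nested_partitions_dyadic_cubes:
  fixes \<mu> :: "(real ^ 'd) measure"
  assumes "prob_space \<mu>" and sets: "sets \<mu> = sets borel" and full: "measure \<mu> half_open_unit_cube = 1"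
  shows "nested_partitions (restrict_space \<mu> half_open_unit_cube) dyadic_cubes (\<lambda>l. 2 ^ (l * CARD('d)))"
proof -
  interpret \<mu>: prob_space \<mu> by fact
  have sp: "space \<mu> = UNIV" using sets_eq_imp_space_eq[OF sets] by simp
  have U: "half_open_unit_cube \<in> sets \<mu>" using half_open_unit_cube_borel by (simp add: sets)
  interpret prob_space "restrict_space \<mu> half_open_unit_cube"
    using U full by (intro prob_space_restrict_space) (auto simp: \<mu>.emeasure_eq_measure)
  show ?thesis
  proof
    show "finite (dyadic_cubes n)" for n by (rule finite_dyadic_cubes)
    show "Q \<in> events" if "Q \<in> dyadic_cubes n" for Q n
      using that U dyadic_cube_subset[OF that] dyadic_cube_borel[OF that]
      by (subst sets_restrict_space_iff) (auto simp: sp sets)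
    show "Q = R" if "Q \<in> dyadic_cubes n" "R \<in> dyadic_cubes n" "x \<in> Q" "x \<in> R"
      for Q R n and x :: "real ^ 'd"
      using that dyadic_box_unique by (auto simp: dyadic_cubes_eq_image)
    show "\<exists>Q\<in>dyadic_cubes n. x \<in> Q" if "x \<in> space (restrict_space \<mu> half_open_unit_cube)" for x n
      using that by (intro dyadic_cubes_cover) (simp add: space_restrict_space)
    show "R \<subseteq> Q" if "m \<le> n" "R \<in> dyadic_cubes n" "Q \<in> dyadic_cubes m" "x \<in> R" "x \<in> Q"
      for m n Q R and x :: "real ^ 'd"
    proof
      note h = that
      fix y assume y: "y \<in> R"
      obtain j q where jq: "R = dyadic_box n j" "Q = dyadic_box m q"
        using h(2,3) unfolding dyadic_cubes_eq_image by blast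
      show "y \<in> Q"
        using y h(4,5) floor_coarser_dyadic[OF h(1)] unfolding jq mem_dyadic_box by simp
    qed
    show "card {R \<in> dyadic_cubes (n + l). R \<subseteq> Q} \<le> 2 ^ (l * CARD('d))"
      if "Q \<in> dyadic_cubes n" for Q :: "(real ^ 'd) set" and n l
      using card_subcubes_le[OF that, of l] by (simp add: subcubes_def)
  qed
qed

text \<open>The points of the closed unit cube that are missing from the half-open one have some coordinate
  equal to 1. They lie in the closure of a cube of level 1 without belonging to any cube, hence in a
  frontier, and there are finitely many of those.\<close>

lemma half_open_unit_cube_full_measure:
  fixes \<mu> :: "(real ^ 'd) measure"
  assumes "prob_space \<mu>" and sets: "sets \<mu> = sets borel" and full: "measure \<mu> (cbox 0 1) = 1"
    and frontier: "\<And>Q. Q \<in> dyadic_cubes 1 \<Longrightarrow> measure \<mu> (frontier Q) = 0"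
  shows "measure \<mu> half_open_unit_cube = 1"
proof -
  interpret \<mu>: prob_space \<mu> by fact
  let ?U = "half_open_unit_cube :: (real ^ 'd) set" and ?F = "\<Union>(frontier ` (dyadic_cubes 1 :: (real ^ 'd) set set))"
  have F: "frontier Q \<in> sets \<mu>" for Q :: "(real ^ 'd) set" by (simp add: sets borel_closed)
  have F_ev: "?F \<in> sets \<mu>" using finite_dyadic_cubes F by (intro sets.finite_Union) auto
  have "measure \<mu> ?F \<le> (\<Sum>Q\<in>dyadic_cubes 1. measure \<mu> (frontier Q))"
    using F by (intro \<mu>.finite_measure_subadditive_finite finite_dyadic_cubes) auto
  then have F0: "measure \<mu> ?F = 0" by (simp add: frontier measure_le_0_iff)
  have "cbox 0 1 \<subseteq> ?U \<union> ?F"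
  proof
    fix x :: "real ^ 'd" assume "x \<in> cbox 0 1"
    then have x: "0 \<le> x $ i" "x $ i \<le> 1" for i by (auto simp: mem_box_cart)
    show "x \<in> ?U \<union> ?F"
    proof (cases "x \<in> ?U")
      case False
      \<comment> \<open>Approximation of \<open>x\<close> from inside one cube, moving only the coordinates equal to 1 and by at most
        \<open>1/2\<close>, the side length of the cube.\<close>
      define y where "y k = (\<chi> i. if x $ i = 1 then 1 - inverse (real (Suc (Suc k))) else x $ i)" for k :: nat
      define j where "j i = (if x $ i = 1 then 1 else nat \<lfloor>2 * x $ i\<rfloor>)" for i
      have j: "j i < 2" for i
        using x[of i] by (auto simp: j_def nat_less_iff floor_less_iff)
      have "y k \<in> dyadic_box 1 j" for k
      proof -
        have "\<lfloor>2 * (y k $ i)\<rfloor> = int (j i)" for i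
        proof (cases "x $ i = 1")
          case True
          have "\<lfloor>2 * (1 - v)\<rfloor> = 1" if "0 < v" "v \<le> 1 / 2" for v :: real
            using that by (simp add: floor_eq_iff)
          moreover have "0 < inverse (real (Suc (Suc k)))" "inverse (real (Suc (Suc k))) \<le> 1 / 2"
            by (simp_all add: field_simps)
          ultimately have "\<lfloor>2 * (1 - inverse (real (Suc (Suc k))))\<rfloor> = 1" by blast
          then show ?thesis using True by (simp add: y_def j_def del: of_nat_Suc)
        qed (use x[of i] in \<open>simp add: y_def j_def\<close>)
        then show ?thesis by (simp add: mem_dyadic_box)
      qed
      moreover have "y \<longlonglongrightarrow> x"
      proof (rule vec_tendstoI)
        fix i
        have "(\<lambda>k. 1 - inverse (real (Suc (Suc k)))) \<longlonglongrightarrow> 1 - 0"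
          by (intro tendsto_diff tendsto_const LIMSEQ_Suc[OF LIMSEQ_inverse_real_of_nat])
        then show "(\<lambda>k. y k $ i) \<longlonglongrightarrow> x $ i" by (cases "x $ i = 1") (simp_all add: y_def)
      qed
      ultimately have "x \<in> closure (dyadic_box 1 j)" unfolding closure_sequential by blast
      moreover have Q: "dyadic_box 1 j \<in> dyadic_cubes 1" using j by (auto simp: dyadic_cubes_eq_image)
      then have "x \<notin> interior (dyadic_box 1 j)"
        using False dyadic_cube_subset interior_subset by blast
      ultimately show ?thesis using Q by (auto simp: frontier_def)
    qed simp
  qed
  then have "measure \<mu> (cbox 0 1) \<le> measure \<mu> (?U \<union> ?F)"
    using F_ev half_open_unit_cube_borel by (intro \<mu>.finite_measure_mono) (auto simp: sets)
  also have "\<dots> \<le> measure \<mu> ?U + measure \<mu> ?F"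
    using F_ev half_open_unit_cube_borel by (intro measure_Un_le) (auto simp: sets)
  finally show ?thesis using full F0 \<mu>.prob_le_1[of ?U] by linarith
qed

text \<open>The Euclidean distance of two points in the same cube is at most the sum of the \<open>d\<close> coordinate
  differences, each less than \<open>2\<^sup>-\<^sup>n\<^sup>-\<^sup>d\<close>; the extra \<open>d\<close> levels absorb their number because \<open>d \<le> 2\<^sup>d\<close>.\<close>

lemma dyadic_box_subset_ball:
  fixes x :: "real ^ 'd"
  assumes "x \<in> dyadic_box (n + CARD('d)) j"
  shows "dyadic_box (n + CARD('d)) j \<subseteq> ball x (1 / 2 ^ n)"
proof
  fix y assume y: "y \<in> dyadic_box (n + CARD('d)) j"
  let ?m = "n + CARD('d)"
  have close: "\<bar>(y - x) $ i\<bar> < 1 / 2 ^ ?m" for i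
  proof -
    have "\<lfloor>2 ^ ?m * x $ i\<rfloor> = \<lfloor>2 ^ ?m * y $ i\<rfloor>" using assms y by (simp add: mem_dyadic_box)
    then have "\<bar>2 ^ ?m * y $ i - 2 ^ ?m * x $ i\<bar> < 1" by linarith
    then have "2 ^ ?m * \<bar>(y - x) $ i\<bar> < 1"
      unfolding right_diff_distrib[symmetric] abs_mult by simp
    then show ?thesis by (simp add: pos_less_divide_eq mult.commute)
  qed
  have "norm (y - x) \<le> (\<Sum>i\<in>UNIV. \<bar>(y - x) $ i\<bar>)" by (rule norm_le_l1_cart)
  also have "\<dots> < (\<Sum>i\<in>(UNIV :: 'd set). 1 / 2 ^ ?m)" by (intro sum_strict_mono close) auto
  also have "\<dots> = real CARD('d) / 2 ^ ?m" by simp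
  also have "\<dots> \<le> 2 ^ CARD('d) / 2 ^ ?m"
    using of_nat_mono[OF less_imp_le[OF less_exp[of "CARD('d)"]], where 'a = real]
    by (intro divide_right_mono) simp_all
  also have "\<dots> = 1 / 2 ^ n" by (simp add: power_add)
  finally show "y \<in> ball x (1 / 2 ^ n)" by (simp add: dist_norm norm_minus_commute)
qed

text \<open>Points at distance less than the side length have dyadic indices that differ by at most one in each
  coordinate.\<close>

lemma card_dyadic_cubes_near_point:
  fixes y :: "real ^ 'd"
  assumes "y \<in> half_open_unit_cube"
  shows "card {R \<in> dyadic_cubes n. y \<in> (\<Union>x\<in>R. ball x (1 / 2 ^ n))} \<le> 3 ^ CARD('d)"
proof -
  define f where "f i = nat \<lfloor>2 ^ n * y $ i\<rfloor>" for i
  have f: "\<lfloor>2 ^ n * y $ i\<rfloor> = int (f i)" for i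
    using assms by (simp add: f_def half_open_unit_cube_def)
  let ?A = "\<lambda>i. {f i - 1..f i + 1}"
  have "{R \<in> dyadic_cubes n. y \<in> (\<Union>x\<in>R. ball x (1 / 2 ^ n))} \<subseteq> dyadic_box n ` {j. \<forall>i. j i \<in> ?A i}"
  proof clarsimp
    fix R x assume "R \<in> dyadic_cubes n" and xR: "x \<in> R" and d: "dist x y < 1 / 2 ^ n"
    then obtain j where R: "R = dyadic_box n j" by (auto simp: dyadic_cubes_eq_image)
    have "j i \<in> ?A i" for i
    proof -
      have "\<bar>(x - y) $ i\<bar> < 1 / 2 ^ n"
        using component_le_norm_cart[of "x - y" i] d by (simp add: dist_norm)
      then have "\<bar>2 ^ n * x $ i - 2 ^ n * y $ i\<bar> < 1"
        unfolding right_diff_distrib[symmetric] abs_mult by (simp add: pos_less_divide_eq mult.commute)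
      moreover have "\<lfloor>2 ^ n * x $ i\<rfloor> = int (j i)" using xR R by (simp add: mem_dyadic_box)
      ultimately have "int (j i) \<le> int (f i) + 1" "int (f i) \<le> int (j i) + 1"
        using f[of i] by linarith+
      then show ?thesis by auto
    qed
    then show "R \<in> dyadic_box n ` {j. \<forall>i. f i - Suc 0 \<le> j i \<and> j i \<le> Suc (f i)}" using R by auto
  qed
  moreover note fin = finite_card_bounded_functions[of ?A 3]
  ultimately have "card {R \<in> dyadic_cubes n. y \<in> (\<Union>x\<in>R. ball x (1 / 2 ^ n))}
      \<le> card (dyadic_box n ` {j. \<forall>i. j i \<in> ?A i})"
    by (intro card_mono finite_imageI fin) auto
  also have "\<dots> \<le> card {j. \<forall>i. j i \<in> ?A i}" by (intro card_image_le fin) auto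
  also have "\<dots> \<le> 3 ^ CARD('d)" by (intro fin) auto
  finally show ?thesis .
qed

section \<open>Local dimensions along dyadic scales\<close>
lemma Limsup_eq_of_difference_vanishing:
  fixes f h :: "'b \<Rightarrow> real"
  assumes F: "F \<noteq> bot" and lim: "((\<lambda>x. f x - h x) \<longlongrightarrow> 0) F"
  shows "Limsup F (\<lambda>x. ereal (f x)) = Limsup F (\<lambda>x. ereal (h x))"
proof -
  have le: "Limsup F (\<lambda>x. ereal (f x)) \<le> Limsup F (\<lambda>x. ereal (h x))"
    if lim: "((\<lambda>x. f x - h x) \<longlongrightarrow> 0) F" for f h :: "'b \<Rightarrow> real"
  proof (rule ereal_le_epsilon2)
    fix e :: real assume "0 < e"
    with lim have "eventually (\<lambda>x. f x - h x < e) F" by (auto dest: order_tendstoD)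
    then have "Limsup F (\<lambda>x. ereal (f x)) \<le> Limsup F (\<lambda>x. ereal (h x) + ereal e)"
      by (intro Limsup_mono) (auto elim!: eventually_mono)
    also have "\<dots> = Limsup F (\<lambda>x. ereal (h x)) + ereal e"
      using F by (intro Limsup_add_ereal_right) auto
    finally show "Limsup F (\<lambda>x. ereal (f x)) \<le> Limsup F (\<lambda>x. ereal (h x)) + ereal e" .
  qed
  have "((\<lambda>x. h x - f x) \<longlongrightarrow> 0) F" using tendsto_minus[OF lim] by simp
  with le lim show ?thesis by (intro antisym) auto
qed

lemma Limsup_compose_filterlim_le:
  fixes f :: "'b \<Rightarrow> ereal"
  assumes "filterlim g G F"
  shows "Limsup F (\<lambda>x. f (g x)) \<le> Limsup G f"
  unfolding Limsup_def[of G]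
proof (rule INF_greatest)
  fix P assume "P \<in> {P. eventually P G}"
  then have "eventually (\<lambda>x. P (g x)) F" using assms by (auto simp: filterlim_iff)
  then show "Limsup F (\<lambda>x. f (g x)) \<le> (SUP x\<in>Collect P. f x)"
    by (intro Limsup_bounded) (auto elim!: eventually_mono intro: SUP_upper)
qed

lemma scale_index_pow2: "nat \<lfloor>- log 2 (1 / 2 ^ n)\<rfloor> = n"
proof -
  have "log 2 (1 / 2 ^ n) = - real n" by (simp add: log_divide log_nat_power)
  then show ?thesis by simp
qed

lemma filterlim_scale_index: "filterlim (\<lambda>r. nat \<lfloor>- log 2 r\<rfloor>) at_top (at_right (0::real))"
  unfolding filterlim_at_top
proof
  fix Z :: nat
  have "eventually (\<lambda>r::real. r \<in> {0<..<1 / 2 ^ Z}) (at_right 0)"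
    by (rule eventually_at_right_real) simp
  then show "eventually (\<lambda>r. Z \<le> nat \<lfloor>- log 2 r\<rfloor>) (at_right (0::real))"
  proof eventually_elim
    case (elim r)
    then have "log 2 r \<le> log 2 (1 / 2 ^ Z)" by (subst log_le_cancel_iff) auto
    then have "real Z \<le> - log 2 r" by (simp add: log_divide log_nat_power)
    then show ?case by linarith
  qed
qed

lemma filterlim_dyadic_scales: "filterlim (\<lambda>n. 1 / 2 ^ n :: real) (at_right 0) sequentially"
  unfolding filterlim_at
  using LIMSEQ_divide_realpow_zero[of 2 1] by (auto intro!: always_eventually)

text \<open>The integer scale \<open>\<lfloor>- log r\<rfloor>\<close> tends to infinity as \<open>r\<close> tends to 0, and the radii \<open>2\<^sup>-\<^sup>n\<close> attain every value
  of it, so neither side can exceed the other.\<close>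

lemma Limsup_at_right_eq_limsup:
  fixes f :: "real \<Rightarrow> real" and b :: "nat \<Rightarrow> real"
  assumes "((\<lambda>r. f r - b (nat \<lfloor>- log 2 r\<rfloor>)) \<longlongrightarrow> 0) (at_right 0)"
  shows "Limsup (at_right 0) (\<lambda>r. ereal (f r)) = limsup (\<lambda>n. ereal (b n))"
proof -
  let ?N = "\<lambda>r::real. nat \<lfloor>- log 2 r\<rfloor>"
  have "Limsup (at_right 0) (\<lambda>r. ereal (f r)) = Limsup (at_right 0) (\<lambda>r. ereal (b (?N r)))"
    by (rule Limsup_eq_of_difference_vanishing[OF _ assms]) simp
  also have "\<dots> = limsup (\<lambda>n. ereal (b n))"
  proof (rule antisym)
    show "Limsup (at_right 0) (\<lambda>r. ereal (b (?N r))) \<le> limsup (\<lambda>n. ereal (b n))"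
      by (rule Limsup_compose_filterlim_le[OF filterlim_scale_index])
    have "limsup (\<lambda>n. ereal (b (?N (1 / 2 ^ n)))) \<le> Limsup (at_right 0) (\<lambda>r. ereal (b (?N r)))"
      by (rule Limsup_compose_filterlim_le[OF filterlim_dyadic_scales])
    then show "limsup (\<lambda>n. ereal (b n)) \<le> Limsup (at_right 0) (\<lambda>r. ereal (b (?N r)))"
      by (simp only: scale_index_pow2)
  qed
  finally show ?thesis .
qed

lemma Liminf_at_right_eq_liminf:
  fixes f :: "real \<Rightarrow> real" and b :: "nat \<Rightarrow> real"
  assumes "((\<lambda>r. f r - b (nat \<lfloor>- log 2 r\<rfloor>)) \<longlongrightarrow> 0) (at_right 0)"
  shows "Liminf (at_right 0) (\<lambda>r. ereal (f r)) = liminf (\<lambda>n. ereal (b n))"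
proof -
  have "((\<lambda>r. - f r - - b (nat \<lfloor>- log 2 r\<rfloor>)) \<longlongrightarrow> 0) (at_right 0)"
    using tendsto_minus[OF assms] by simp
  then have "Limsup (at_right 0) (\<lambda>r. - ereal (f r)) = limsup (\<lambda>n. - ereal (b n))"
    using Limsup_at_right_eq_limsup[of "\<lambda>r. - f r" "\<lambda>n. - b n"] by simp
  then show ?thesis unfolding ereal_Limsup_uminus by simp
qed

text \<open>Since \<open>G\<close> is monotone and \<open>2\<^sup>-\<^sup>n\<^sup>-\<^sup>1 \<le> r \<le> 2\<^sup>-\<^sup>n\<close> for \<open>n = \<lfloor>- log r\<rfloor>\<close>, the two hypotheses at dyadic scales give
  \<open>G r = g n + o(n)\<close>. Boundedness of \<open>g n / n\<close> is what allows replacing the denominator \<open>- log r\<close> by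
  its integer part.\<close>

lemma local_dimension_quotient_along_scales:
  fixes G :: "real \<Rightarrow> real" and g :: "nat \<Rightarrow> real"
  assumes anti: "\<And>r s. 0 < r \<Longrightarrow> r \<le> s \<Longrightarrow> G s \<le> G r"
    and lower: "\<And>e. 0 < e \<Longrightarrow> eventually (\<lambda>n. g n - e * real n \<le> G (1 / 2 ^ n)) sequentially"
    and upper: "\<And>e. 0 < e \<Longrightarrow> eventually (\<lambda>n. G (1 / 2 ^ Suc n) \<le> g n + e * real n) sequentially"
    and bounded: "Bseq (\<lambda>n. g n / real n)"
  shows "((\<lambda>r. G r / (- log 2 r) - g (nat \<lfloor>- log 2 r\<rfloor>) / real (nat \<lfloor>- log 2 r\<rfloor>)) \<longlongrightarrow> 0) (at_right 0)"
proof -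
  define N where "N r = nat \<lfloor>- log 2 r\<rfloor>" for r :: real
  have N_top: "filterlim N at_top (at_right 0)" unfolding N_def by (rule filterlim_scale_index)
  have N_pos: "eventually (\<lambda>r. 0 < r \<and> 0 < N r \<and> real (N r) \<le> - log 2 r \<and> - log 2 r < real (N r) + 1) (at_right 0)"
    using filterlim_at_top[THEN iffD1, OF N_top, THEN spec, of 1] eventually_at_right_less
    by eventually_elim (unfold N_def, linarith)
  have err: "((\<lambda>r. (G r - g (N r)) / real (N r)) \<longlongrightarrow> 0) (at_right 0)"
    unfolding tendsto_iff dist_real_def
  proof (intro allI impI)
    fix e :: real assume e: "0 < e"
    have "eventually (\<lambda>n. g n - (e/2) * real n \<le> G (1 / 2 ^ n) \<and> G (1 / 2 ^ Suc n) \<le> g n + (e/2) * real n) sequentially"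
      using lower[of "e/2"] upper[of "e/2"] e by (auto intro: eventually_conj)
    then have "eventually (\<lambda>r. g (N r) - (e/2) * real (N r) \<le> G (1 / 2 ^ N r)
        \<and> G (1 / 2 ^ Suc (N r)) \<le> g (N r) + (e/2) * real (N r)) (at_right 0)"
      using N_top by (auto simp: filterlim_iff)
    then show "eventually (\<lambda>r. \<bar>(G r - g (N r)) / real (N r) - 0\<bar> < e) (at_right 0)"
      using N_pos
    proof eventually_elim
      case (elim r)
      have r: "r = 2 powr (log 2 r)" using elim by simp
      have p: "1 / 2 ^ k = 2 powr (- real k)" for k by (simp add: powr_minus_divide powr_realpow)
      have "r \<le> 1 / 2 ^ N r"
        unfolding p by (subst r, subst powr_le_cancel_iff) (use elim in auto)
      then have 1: "G (1 / 2 ^ N r) \<le> G r" using elim by (intro anti) auto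
      have "1 / 2 ^ Suc (N r) \<le> r"
        unfolding p by (subst (2) r, subst powr_le_cancel_iff) (use elim in auto)
      then have 2: "G r \<le> G (1 / 2 ^ Suc (N r))" by (intro anti) auto
      have "\<bar>G r - g (N r)\<bar> \<le> (e/2) * real (N r)" using 1 2 elim by linarith
      also have "\<dots> < e * real (N r)" using e elim by simp
      finally show ?case using elim by (simp add: abs_divide pos_divide_less_eq)
    qed
  qed
  have ratio: "((\<lambda>r. real (N r) / (- log 2 r)) \<longlongrightarrow> 1) (at_right 0)"
  proof (rule tendsto_sandwich)
    have "(\<lambda>n. real n / (real n + 1)) \<longlonglongrightarrow> 1" using LIMSEQ_n_over_Suc_n by (simp add: add.commute)
    from filterlim_compose[OF this N_top]
    show "((\<lambda>r. real (N r) / (real (N r) + 1)) \<longlongrightarrow> 1) (at_right 0)" .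
    show "eventually (\<lambda>r. real (N r) / (real (N r) + 1) \<le> real (N r) / (- log 2 r)) (at_right 0)"
      using N_pos
    proof eventually_elim
      case (elim r)
      define L where "L = - log 2 r"
      have "0 < L" "L \<le> real (N r) + 1" unfolding L_def using elim by linarith+
      then show ?case unfolding L_def[symmetric] by (intro divide_left_mono) auto
    qed
    show "eventually (\<lambda>r. real (N r) / (- log 2 r) \<le> 1) (at_right 0)"
      using N_pos by eventually_elim (subst divide_le_eq_1_pos; linarith)
  qed simp
  obtain B where B: "\<And>n. \<bar>g n / real n\<bar> \<le> B" using bounded by (auto simp: Bseq_def)
  have "((\<lambda>r. g (N r) / real (N r) * (real (N r) / (- log 2 r) - 1)) \<longlongrightarrow> 0) (at_right 0)"
  proof (rule Lim_null_comparison)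
    show "eventually (\<lambda>r. norm (g (N r) / real (N r) * (real (N r) / (- log 2 r) - 1))
            \<le> B * \<bar>real (N r) / (- log 2 r) - 1\<bar>) (at_right 0)"
      by (intro always_eventually allI) (simp only: real_norm_def abs_mult, intro mult_right_mono B, simp)
    show "((\<lambda>r. B * \<bar>real (N r) / (- log 2 r) - 1\<bar>) \<longlongrightarrow> 0) (at_right 0)"
      by (rule tendsto_eq_intros ratio refl)+ simp
  qed
  from tendsto_add[OF tendsto_mult[OF err ratio] this]
  have "((\<lambda>r. (G r - g (N r)) / real (N r) * (real (N r) / (- log 2 r))
      + g (N r) / real (N r) * (real (N r) / (- log 2 r) - 1)) \<longlongrightarrow> 0) (at_right 0)" by simp
  then show ?thesis
    unfolding N_def[symmetric]
  proof (rule Lim_transform_eventually)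
    show "eventually (\<lambda>r. (G r - g (N r)) / real (N r) * (real (N r) / (- log 2 r))
      + g (N r) / real (N r) * (real (N r) / (- log 2 r) - 1) = G r / (- log 2 r) - g (N r) / real (N r)) (at_right 0)"
      using N_pos
    proof eventually_elim
      case (elim r)
      define L where "L = - log 2 r"
      have "L > 0" "real (N r) > 0" unfolding L_def using elim by linarith+
      then show ?case unfolding L_def[symmetric] by (simp add: field_simps)
    qed
  qed
qed

text \<open>In applications \<open>g n\<close> is \<open>- log\<close> of the mass of the level \<open>n\<close> cell around \<open>x\<close>, and the hypotheses
  \<open>lower\<close> and \<open>upper\<close> are all that is kept of the geometry: the ball of radius \<open>2\<^sup>-\<^sup>n\<close> is not much heavier
  than the cell, and the ball half as large is not much lighter.\<close>

lemma local_dims_eq_limits_of_cell_averages: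
  fixes \<mu> :: "'a::metric_space measure" and g b :: "nat \<Rightarrow> real"
  assumes "finite_measure \<mu>" and sets: "sets \<mu> = sets borel"
    and pos: "\<And>r. 0 < r \<Longrightarrow> 0 < measure \<mu> (ball x r)"
    and lower: "\<And>e. 0 < e \<Longrightarrow>
      eventually (\<lambda>n. g n - e * real n \<le> - log 2 (measure \<mu> (ball x (1 / 2 ^ n)))) sequentially"
    and upper: "\<And>e. 0 < e \<Longrightarrow>
      eventually (\<lambda>n. - log 2 (measure \<mu> (ball x (1 / 2 ^ Suc n))) \<le> g n + e * real n) sequentially"
    and lim: "(\<lambda>n. g n / real n - b n) \<longlonglongrightarrow> 0" and b: "Bseq b"
  shows "upper_local_dim \<mu> x = limsup (\<lambda>n. ereal (b n))
    \<and> lower_local_dim \<mu> x = liminf (\<lambda>n. ereal (b n))"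
proof -
  interpret finite_measure \<mu> by fact
  define G where "G r = - log 2 (measure \<mu> (ball x r))" for r
  let ?N = "\<lambda>r::real. nat \<lfloor>- log 2 r\<rfloor>"
  have bounded: "Bseq (\<lambda>n. g n / real n)"
  proof -
    have "Bseq (\<lambda>n. g n / real n - b n)"
      using lim by (intro convergent_imp_Bseq convergentI)
    then obtain K1 where K1: "\<And>n. norm (g n / real n - b n) \<le> K1" by (auto simp: Bseq_def)
    obtain K2 where K2: "\<And>n. norm (b n) \<le> K2" using b by (auto simp: Bseq_def)
    have "norm (g n / real n) \<le> K1 + K2" for n
      using norm_triangle_le[OF add_mono[OF K1[of n] K2[of n]]] by simp
    then show ?thesis by (rule BseqI')
  qed
  have quot: "((\<lambda>r. G r / (- log 2 r) - g (?N r) / real (?N r)) \<longlongrightarrow> 0) (at_right 0)"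
  proof (rule local_dimension_quotient_along_scales[OF _ _ _ bounded])
    fix r s :: real assume r: "0 < r" "r \<le> s"
    then have "measure \<mu> (ball x r) \<le> measure \<mu> (ball x s)"
      by (intro finite_measure_mono) (auto simp: sets)
    then show "G s \<le> G r"
      unfolding G_def using pos r by simp
  qed (use lower upper in \<open>simp_all add: G_def\<close>)
  have "((\<lambda>r. g (?N r) / real (?N r) - b (?N r)) \<longlongrightarrow> 0) (at_right 0)"
    by (rule filterlim_compose[OF lim filterlim_scale_index])
  from tendsto_add[OF quot this]
  have diff: "((\<lambda>r. G r / (- log 2 r) - b (?N r)) \<longlongrightarrow> 0) (at_right 0)" by simp
  have ev: "eventually (\<lambda>r. elog2 (measure \<mu> (ball x r)) / ereal (log 2 r) = ereal (G r / (- log 2 r))) (at_right 0)"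
    using eventually_at_right_real[OF zero_less_one]
  proof eventually_elim
    case (elim r)
    then have "log 2 r < 0" "0 < measure \<mu> (ball x r)" using pos by auto
    then show ?case by (simp add: elog2_def G_def)
  qed
  have "upper_local_dim \<mu> x = Limsup (at_right 0) (\<lambda>r. ereal (G r / (- log 2 r)))"
    unfolding upper_local_dim_def by (rule Limsup_eq[OF ev])
  then have "upper_local_dim \<mu> x = limsup (\<lambda>n. ereal (b n))"
    using Limsup_at_right_eq_limsup[OF diff] by simp
  moreover have "lower_local_dim \<mu> x = Liminf (at_right 0) (\<lambda>r. ereal (G r / (- log 2 r)))"
    unfolding lower_local_dim_def by (rule Liminf_eq[OF ev])
  then have "lower_local_dim \<mu> x = liminf (\<lambda>n. ereal (b n))"
    using Liminf_at_right_eq_liminf[OF diff] by simp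
  ultimately show ?thesis ..
qed

section \<open>Local dimension and average entropy\<close>

theorem theorem5:
  fixes \<mu> :: "(real ^ 'd) measure" and l :: nat
  assumes "l \<ge> 1"
    and "prob_space \<mu>" and "sets \<mu> = sets borel" and "measure \<mu> (cbox 0 1) = 1"
    and "\<And>n Q. n \<ge> 1 \<Longrightarrow> Q \<in> dyadic_cubes n \<Longrightarrow> measure \<mu> (frontier Q) = 0"
  shows "(AE x in \<mu>.
            (\<lambda>n. 1 / real n * (- log 2 (measure \<mu> (dyadic_cube_at n x))
                   - 1 / real l * (\<Sum>i=1..n. cube_entropy \<mu> l i x))) \<longlonglongrightarrow> 0) \<and>
         (AE x in \<mu>.
            upper_local_dim \<mu> x
              = limsup (\<lambda>n. ereal (1 / (real l * real n) * (\<Sum>i=1..n. cube_entropy \<mu> l i x))) \<and>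
            lower_local_dim \<mu> x
              = liminf (\<lambda>n. ereal (1 / (real l * real n) * (\<Sum>i=1..n. cube_entropy \<mu> l i x))))"
proof -
  let ?U = "half_open_unit_cube :: (real ^ 'd) set"
  interpret \<mu>: prob_space \<mu> by fact
  have sp: "space \<mu> = UNIV" using sets_eq_imp_space_eq[OF assms(3)] by simp
  have U: "?U \<in> sets \<mu>" using half_open_unit_cube_borel by (simp add: assms(3))
  have full: "measure \<mu> ?U = 1"
    using assms(2-5) by (intro half_open_unit_cube_full_measure) auto
  have AE_U: "AE x in \<mu>. x \<in> ?U" using \<mu>.AE_in_set_eq_1[OF U] full by simp
  \<comment> \<open>Restricting to the half-open cube makes the dyadic cubes partition the whole space; the
    measures of cubes, hence all entropies, are unchanged.\<close>
  let ?M = "restrict_space \<mu> ?U"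
  interpret P: nested_partitions ?M dyadic_cubes "\<lambda>l. 2 ^ (l * CARD('d))"
    by (rule nested_partitions_dyadic_cubes[OF assms(2,3) full])
  have meas: "P.prob A = measure \<mu> A" if "A \<subseteq> ?U" for A
    using U that by (intro measure_restrict_space) (auto simp: sp)
  have transfer: "AE x in \<mu>. Q x" if "AE x in ?M. Q x" for Q
  proof -
    have "AE x in \<mu>. x \<in> ?U \<longrightarrow> Q x" using that U by (subst (asm) AE_restrict_space_iff) (auto simp: sp)
    with AE_U show ?thesis by eventually_elim simp
  qed
  have spM: "space ?M = ?U" by (simp add: space_restrict_space sp)
  have cell: "P.cell n x = dyadic_cube_at n x" for n x
    by (simp add: P.cell_def dyadic_cube_at_def)
  have cell_U: "dyadic_cube_at n x \<subseteq> ?U" if "x \<in> ?U" for n x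
    using P.cell_mem(1)[of x n] that by (simp add: spM cell dyadic_cube_subset)
  have ent: "P.entropy_at k n x = cube_entropy \<mu> k n x" if "x \<in> ?U" for k n x
  proof -
    have "P.children n k (dyadic_cube_at n x) = subcubes n k (dyadic_cube_at n x)"
      by (simp add: P.children_def subcubes_def)
    moreover have "conditional_vector ?M (dyadic_cube_at n x) R = conditional_vector \<mu> (dyadic_cube_at n x) R"
      if "R \<in> subcubes n k (dyadic_cube_at n x)" for R
    proof -
      have "R \<subseteq> ?U" using that cell_U[OF \<open>x \<in> ?U\<close>, of n] by (auto simp: subcubes_def)
      then show ?thesis using cell_U[OF \<open>x \<in> ?U\<close>, of n] by (simp add: conditional_vector_def meas)
    qed
    ultimately show ?thesis
      by (simp add: P.entropy_at_def cube_entropy_def cell vector_entropy_def)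
  qed
  define N where "N n R = (\<Union>x\<in>R. ball x (1 / 2 ^ n)) \<inter> ?U" for n and R :: "(real ^ 'd) set"
  have N_ev: "N n R \<in> P.events" for n R
  proof -
    have "(\<Union>x\<in>R. ball x (1 / 2 ^ n)) \<in> sets borel" by (intro borel_open) auto
    then have "N n R \<in> sets \<mu>" using U by (simp add: N_def assms(3) sets.Int)
    then show ?thesis using U by (subst sets_restrict_space_iff) (auto simp: N_def sp)
  qed
  have balls: "AE x in ?M. \<forall>e>0. eventually (\<lambda>n. P.prob (N n (P.cell n x))
      \<le> 2 powr (e * real n) * P.prob (P.cell n x)) sequentially"
  proof (rule P.AE_neighbourhood_prob_le)
    fix n and y :: "real ^ 'd" assume "y \<in> space ?M"
    then have y: "y \<in> ?U" by (simp add: spM)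
    show "card {R \<in> dyadic_cubes n. y \<in> N n R} \<le> 3 ^ CARD('d)"
      using card_dyadic_cubes_near_point[OF y, of n] y by (simp add: N_def)
  qed (rule N_ev)
  have "AE x in ?M. (\<lambda>n. 1 / real n * (- log 2 (P.prob (P.cell n x))
           - 1 / real l * (\<Sum>i=1..n. P.entropy_at l i x))) \<longlonglongrightarrow> 0"
    by (rule P.AE_log_cell_prob_entropy_averages[OF assms(1)])
  then have main: "AE x in \<mu>. (\<lambda>n. 1 / real n * (- log 2 (measure \<mu> (dyadic_cube_at n x))
           - 1 / real l * (\<Sum>i=1..n. cube_entropy \<mu> l i x))) \<longlonglongrightarrow> 0"
    using AE_U by (elim transfer[THEN AE_mp] AE_mp) (auto simp: cell ent meas cell_U intro!: AE_I2)
  have "AE x in \<mu>.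
            upper_local_dim \<mu> x
              = limsup (\<lambda>n. ereal (1 / (real l * real n) * (\<Sum>i=1..n. cube_entropy \<mu> l i x))) \<and>
            lower_local_dim \<mu> x
              = liminf (\<lambda>n. ereal (1 / (real l * real n) * (\<Sum>i=1..n. cube_entropy \<mu> l i x)))"
    using AE_U main transfer[OF P.AE_cell_prob_pos] transfer[OF P.AE_information_gain_sublinear] transfer[OF balls]
  proof eventually_elim
    case (elim x)
    note x = elim(1)
    define g where "g n = - log 2 (measure \<mu> (dyadic_cube_at n x))" for n
    define b where "b n = 1 / (real l * real n) * (\<Sum>i=1..n. cube_entropy \<mu> l i x)" for n
    have mem: "dyadic_cube_at n x \<in> dyadic_cubes n" "x \<in> dyadic_cube_at n x" for n
      using P.cell_mem[of x n] x by (simp_all add: spM cell)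
    have cell_meas: "P.prob (dyadic_cube_at n x) = measure \<mu> (dyadic_cube_at n x)" for n
      by (rule meas[OF cell_U[OF x]])
    have pos: "0 < measure \<mu> (dyadic_cube_at n x)" for n
      using elim(3)[rule_format, of n] by (simp add: cell cell_meas)
    have cell_ball: "measure \<mu> (dyadic_cube_at (n + CARD('d)) x) \<le> measure \<mu> (ball x (1 / 2 ^ n))" for n
    proof (rule \<mu>.finite_measure_mono)
      show "dyadic_cube_at (n + CARD('d)) x \<subseteq> ball x (1 / 2 ^ n)"
        using mem[of "n + CARD('d)"] dyadic_box_subset_ball[of x n]
        by (auto simp: dyadic_cubes_eq_image)
    qed (simp add: assms(3))
    have ball_pos: "0 < measure \<mu> (ball x r)" if "0 < r" for r
    proof -
      obtain n where n: "(1 / 2) ^ n < r" using real_arch_pow_inv[OF \<open>0 < r\<close>, of "1/2"] by auto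
      have "0 < measure \<mu> (ball x (1 / 2 ^ n))" using pos cell_ball less_le_trans by blast
      also have "\<dots> \<le> measure \<mu> (ball x r)"
        using n by (intro \<mu>.finite_measure_mono subset_ball) (auto simp: assms(3) power_one_over)
      finally show ?thesis .
    qed
    have "upper_local_dim \<mu> x = limsup (\<lambda>n. ereal (b n)) \<and> lower_local_dim \<mu> x = liminf (\<lambda>n. ereal (b n))"
    proof (rule local_dims_eq_limits_of_cell_averages[where g = g])
      show "eventually (\<lambda>n. g n - e * real n \<le> - log 2 (measure \<mu> (ball x (1 / 2 ^ n)))) sequentially"
        if "0 < e" for e
        using elim(5)[rule_format, OF that]
      proof eventually_elim
        case (elim n)
        \<comment> \<open>The ball may leave the unit cube, but only into a null set.\<close>
        have "measure \<mu> (ball x (1 / 2 ^ n)) = measure \<mu> (ball x (1 / 2 ^ n) \<inter> ?U)"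
          using AE_U U by (intro \<mu>.finite_measure_eq_AE) (auto simp: assms(3) half_open_unit_cube_borel)
        also have "\<dots> \<le> measure \<mu> (N n (dyadic_cube_at n x))"
        proof (rule \<mu>.finite_measure_mono)
          show "ball x (1 / 2 ^ n) \<inter> ?U \<subseteq> N n (dyadic_cube_at n x)" using mem(2)[of n] by (auto simp: N_def)
          show "N n (dyadic_cube_at n x) \<in> \<mu>.events"
            unfolding N_def assms(3) by (intro sets.Int borel_open half_open_unit_cube_borel) auto
        qed
        also have "\<dots> = P.prob (N n (P.cell n x))" by (subst meas) (auto simp: N_def cell)
        also have "\<dots> \<le> 2 powr (e * real n) * measure \<mu> (dyadic_cube_at n x)"
          using elim by (simp add: cell cell_meas)
        finally have "log 2 (measure \<mu> (ball x (1 / 2 ^ n)))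
            \<le> log 2 (2 powr (e * real n) * measure \<mu> (dyadic_cube_at n x))"
          using ball_pos[of "1 / 2 ^ n"] by (subst log_le_cancel_iff) (auto simp: pos)
        also have "\<dots> = e * real n - g n"
          using pos[of n] by (subst log_mult_pos) (auto simp: g_def)
        finally show ?case by simp
      qed
      show "eventually (\<lambda>n. - log 2 (measure \<mu> (ball x (1 / 2 ^ Suc n))) \<le> g n + e * real n) sequentially"
        if "0 < e" for e
      proof -
        \<comment> \<open>One level to pass from radius \<open>2\<^sup>-\<^sup>n\<close> to half of it, and \<open>d\<close> levels to fit a cube into the ball.\<close>
        let ?j = "Suc CARD('d)"
        have "eventually (\<lambda>n. P.information_gain ?j n x / real n < e) sequentially"
          using elim(4)[rule_format, of ?j] that by (rule order_tendstoD)
        then show ?thesis using eventually_gt_at_top[of 0]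
        proof eventually_elim
          case (elim n)
          have "P.information_gain ?j n x < e * real n"
            using elim by (simp add: pos_divide_less_eq)
          moreover have "P.information_gain ?j n x = g (n + ?j) - g n"
            using pos[of n] pos[of "n + ?j"]
            by (simp add: P.information_gain_def conditional_vector_def cell cell_meas g_def log_divide_pos)
          moreover have "- log 2 (measure \<mu> (ball x (1 / 2 ^ Suc n))) \<le> g (n + ?j)"
            using cell_ball[of "Suc n"] pos[of "n + ?j"] ball_pos[of "1 / 2 ^ Suc n"] by (simp add: g_def)
          ultimately show ?case by linarith
        qed
      qed
      have "g n / real n - b n = 1 / real n * (- log 2 (measure \<mu> (dyadic_cube_at n x))
                   - 1 / real l * (\<Sum>i=1..n. cube_entropy \<mu> l i x))" for n
        by (simp add: g_def b_def diff_divide_distrib mult.commute)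
      with elim(2) show "(\<lambda>n. g n / real n - b n) \<longlonglongrightarrow> 0" by simp
      show "Bseq b"
      proof (rule BseqI')
        fix n
        let ?K = "2 * real (2 ^ (l * CARD('d)))"
        have H: "0 \<le> cube_entropy \<mu> l i x" "cube_entropy \<mu> l i x \<le> ?K" for i
          using P.entropy_at_bounds[of x l i] x by (simp_all add: spM ent)
        have s: "(\<Sum>i=1..n. cube_entropy \<mu> l i x) \<le> real n * ?K" "0 \<le> (\<Sum>i=1..n. cube_entropy \<mu> l i x)"
          using sum_bounded_above[of "{1..n}" "\<lambda>i. cube_entropy \<mu> l i x" ?K] H
          by (auto intro: sum_nonneg)
        have "norm (b n) = (\<Sum>i=1..n. cube_entropy \<mu> l i x) / (real l * real n)"
          using s by (simp add: b_def)
        also have "\<dots> \<le> real n * ?K / (real l * real n)" by (intro divide_right_mono s) simp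
        also have "\<dots> = (if n = 0 then 0 else ?K / real l)" by simp
        also have "\<dots> \<le> ?K" using assms(1) by (simp add: divide_le_eq mult_le_cancel_left1)
        finally show "norm (b n) \<le> ?K" .
      qed
    qed (use assms(3) ball_pos \<mu>.finite_measure_axioms in auto)
    then show ?case unfolding b_def .
  qed
  with main show ?thesis by blast
qed

end
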